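(* Fix $\delta\in(0,3/2)$ and $n\in\mathbb N$, and let $f=\sum_{k=0}^nL^{n-k}\tilde f_{2k}\in x^\delta L^2(\mathbb D;S^{2n}({}^0T^*\mathbb D))$, where $\tilde f_0\in x^\delta L^2(\mathbb D)$ and $\tilde f_{2k}\in x^\delta L^2(\mathbb D;S^{2k}_{tt}({}^0T^*\mathbb D))$ for $1\le k\le n$. Writing $\tilde f_{2k}=f_{2k,+}dz^{2k}+f_{2k,-}d\bar z^{2k}$ and $\mathcal D=I_{2n}f$, for each $k=n,n-1,\dots,1$ one has, for $z\in\mathbb D^\circ$, $$f_{2k,+}(z)=\int_{\mathcal G_H}\Big(\mathcal D-\sum_{j>k}I_{2j}\tilde f_{2j}\Big)(\beta,a)\,G_{2k}(\beta,a;z)\,d\beta\,da,\qquad f_{2k,-}(z)=\int_{\mathcal G_H}\Big(\mathcal D-\sum_{j>k}I_{2j}\tilde f_{2j}\Big)(\beta,a)\,\overline{G_{2k}(\beta,a;z)}\,d\beta\,da,$$ where $$G_{2k}(\beta,a;z)=\frac{4^k e^{-2ik(\beta+\tan^{-1}a)}}{8\pi^2(4k-2)!\,(1+a^2)^k}\sum_{p=0}^\infty\frac{(p+4k-1)!}{p!}\left(\frac{iaz\,e^{-i(\beta+\tan^{-1}a)}}{\sqrt{1+a^2}}\right)^p.$$ In particular $\tilde f_{2n},\tilde f_{2n-2},\dots,\tilde f_2$ are recovered sequentially from $\mathcal D$.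
   Context: Poincaré disk $\mathbb D$, $g=c^{-2}|dz|^2$, $c=\frac{1-|z|^2}{2}$, bdf $x=\frac{1-|z|^2}{1+|z|^2}$, hyperbolic area $dV_H$. ${}^0T^*\mathbb D$ is spanned by $dz/c,d\bar z/c$; $S^m({}^0T^*\mathbb D)$ complexified symmetric power with Hermitian metric from $g$; $x^\delta L^2(\mathbb D;S^m)$ = sections with $\int x^{-2\delta}|u|_g^2dV_H<\infty$; $S^m_{tt}$ = trace-free, divergence-free symmetric tensors. $L f=\sigma(g\otimes f)$ is the symmetrized product with the metric. $\mathcal G_H=\mathbb R/2\pi\mathbb Z\times\mathbb R$, geodesics $z_{\beta,a}(t)=e^{i\beta}\frac{(2+ia)\tanh(t/2)+ia}{ia\tanh(t/2)-2+ia}$; $I_mf(\beta,a)=\int_{\mathbb R}f(\dot z_{\beta,a}(t)^{\otimes m})dt$. *)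

theory Defs
  imports "HOL-Complex_Analysis.Complex_Analysis"
begin

definition cfac :: "complex \<Rightarrow> real" where
  "cfac z = (1 - (cmod z)^2) / 2"

definition bdf :: "complex \<Rightarrow> real" where
  "bdf z = (1 - (cmod z)^2) / (1 + (cmod z)^2)"

definition gmet :: "complex \<Rightarrow> complex \<Rightarrow> complex" where
  "gmet z v = complex_of_real ((cmod v)^2 / (cfac z)^2)"

definition geod :: "real \<Rightarrow> real \<Rightarrow> real \<Rightarrow> complex" where
  "geod b a t = exp (\<i> * complex_of_real b) *
     (((2 + \<i> * complex_of_real a) * complex_of_real (tanh (t/2)) + \<i> * complex_of_real a) /
      (\<i> * complex_of_real a * complex_of_real (tanh (t/2)) - 2 + \<i> * complex_of_real a))"

definition geod_vel :: "real \<Rightarrow> real \<Rightarrow> real \<Rightarrow> complex" where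
  "geod_vel b a t = vector_derivative (geod b a) (at t)"

text \<open>A symmetric m-tensor field F is represented by its restriction to the diagonal,
  F z v = F_z(v^{\<otimes>m}) (which determines it by polarization).
  Geodesic X-ray transform: I_m F (beta,a) = \<integral> F(z(t), z'(t)) dt.\<close>
definition xray :: "(complex \<Rightarrow> complex \<Rightarrow> complex) \<Rightarrow> real \<Rightarrow> real \<Rightarrow> complex" where
  "xray F b a = (LBINT t. F (geod b a t) (geod_vel b a t))"

text \<open>Trace-free symmetric m-tensor hp dz^m + hm dzbar^m, evaluated on v^{\<otimes>m}.\<close>
definition tt_eval :: "nat \<Rightarrow> (complex \<Rightarrow> complex) \<Rightarrow> (complex \<Rightarrow> complex) \<Rightarrow> complex \<Rightarrow> complex \<Rightarrow> complex" where
  "tt_eval m hp hm z v = hp z * v ^ m + hm z * (cnj v) ^ m"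

text \<open>L^j F = sigma(g^j \<otimes> F), evaluated on v^{\<otimes>(m+2j)}.\<close>
definition Lpow :: "nat \<Rightarrow> (complex \<Rightarrow> complex \<Rightarrow> complex) \<Rightarrow> complex \<Rightarrow> complex \<Rightarrow> complex" where
  "Lpow j F z v = (gmet z v) ^ j * F z v"

definition full_tensor :: "nat \<Rightarrow> (complex \<Rightarrow> complex) \<Rightarrow> (nat \<Rightarrow> complex \<Rightarrow> complex) \<Rightarrow>
    (nat \<Rightarrow> complex \<Rightarrow> complex) \<Rightarrow> complex \<Rightarrow> complex \<Rightarrow> complex" where
  "full_tensor n f0 fp fm z v =
     Lpow n (\<lambda>z v. f0 z) z v + (\<Sum>k=1..n. Lpow (n - k) (tt_eval (2*k) (fp k) (fm k)) z v)"

text \<open>Weighted space x^delta L^2(D): \<integral> x^(-2 delta) |u|^2 dV_H < \<infinity>, dV_H = c^(-2) dLeb.\<close>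
definition wL2_scalar :: "real \<Rightarrow> (complex \<Rightarrow> complex) \<Rightarrow> bool" where
  "wL2_scalar d u \<longleftrightarrow> u \<in> borel_measurable lborel \<and>
     set_integrable lborel (ball 0 1)
       (\<lambda>z. bdf z powr (-2*d) * (cmod (u z))^2 / (cfac z)^2)"

text \<open>For u = hp dz^m + hm dzbar^m one has |u|_g^2 = C_m c^(2m) (|hp|^2+|hm|^2) with a
  positive constant C_m, irrelevant for membership.\<close>
definition wL2_tt :: "real \<Rightarrow> nat \<Rightarrow> (complex \<Rightarrow> complex) \<Rightarrow> (complex \<Rightarrow> complex) \<Rightarrow> bool" where
  "wL2_tt d m hp hm \<longleftrightarrow> hp \<in> borel_measurable lborel \<and> hm \<in> borel_measurable lborel \<and>
     set_integrable lborel (ball 0 1)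
       (\<lambda>z. bdf z powr (-2*d) * (cfac z)^(2*m) * ((cmod (hp z))^2 + (cmod (hm z))^2) / (cfac z)^2)"

text \<open>Divergence-free, in conformal coordinates: div(hp dz^m + hm dzbar^m) has components
  2c^2 d_zbar hp and 2c^2 d_z hm, so it vanishes iff hp is holomorphic and hm antiholomorphic.\<close>
definition div_free_tt :: "(complex \<Rightarrow> complex) \<Rightarrow> (complex \<Rightarrow> complex) \<Rightarrow> bool" where
  "div_free_tt hp hm \<longleftrightarrow> hp holomorphic_on ball 0 1 \<and> (\<lambda>z. cnj (hm z)) holomorphic_on ball 0 1"

definition Gker :: "nat \<Rightarrow> real \<Rightarrow> real \<Rightarrow> complex \<Rightarrow> complex" where
  "Gker k b a z =
     (4 ^ k * exp (- 2 * \<i> * of_nat k * complex_of_real (b + arctan a)) /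
       (8 * complex_of_real (pi^2) * of_nat (fact (4*k - 2)) * complex_of_real ((1 + a^2) ^ k))) *
     (\<Sum>p. (of_nat (fact (p + 4*k - 1)) / of_nat (fact p)) *
        ((\<i> * complex_of_real a * z * exp (- \<i> * complex_of_real (b + arctan a)))
          / complex_of_real (sqrt (1 + a^2))) ^ p)"

end

theory Submission
  imports Defs
begin

text \<open>
  Pairing the data with the kernel and applying Santalo's formula turns the integral over geodesics
  into an integral over the unit tangent bundle. Summing the series, the kernel is a constant times
  \<open>(\<mu> / (1 - \<nu> w)\<^sup>2) ^ (2 * k)\<close>, where \<open>\<mu>\<close> and \<open>\<nu>\<close> are half the difference and half the sum of the
  conjugated endpoints. On the fibre over \<open>z\<close> this is \<open>e ^ (2 * k)\<close> times a power series in \<open>e\<close>, the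
  conjugate of the unit direction, so it annihilates all tensor components of order below \<open>2 * k\<close> and
  all antiholomorphic ones. What remains of the component of order \<open>2 * k\<close> is its pairing with
  \<open>(1 - |z|\<^sup>2) ^ (4 * k - 2) / (1 - cnj z * w) ^ (4 * k)\<close>, a weighted Bergman kernel, which reproduces
  holomorphic functions. Fixing the initial endpoint instead of the point, the fibre measure becomes
  the Poisson kernel, so the fibre integrals are Poisson integrals of holomorphic functions. The
  antiholomorphic part is recovered by conjugating all data.
\<close>

subsection \<open>Change of variables into the complex plane\<close>

text \<open>The order of recovery is forced by the fibre expansion. With \<open>e\<close> the
  conjugate direction, a component of order \<open>2 * j\<close> carries
  \<open>e ^ (- 2 * j)\<close>; for \<open>j > k\<close> this meets a coefficient of the kernel
  series that need not vanish, so the components above \<open>k\<close> have to be subtracted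
  beforehand. The analytic obstacle is that a divergent ray integral has the value 0, so the data of
  a sum need not split into the data of its summands. Splitting is shown for almost every geodesic,
  which suffices under the outer integral: each summand is paired with the nowhere vanishing weight
  \<open>1 / (1 + a^2)\<close>, Tonelli turns absolute convergence into integrability of one
  function on the disk, and the weighted \<open>L^2\<close> condition gives that integrability. The
  constant: the fibre contributes \<open>2 * pi\<close>, the Bergman integral
  \<open>pi / (4 * k - 1)\<close>, and replacing \<open>cfac z\<close> by
  \<open>(1 - |z|^2) / 2\<close> contributes \<open>4 / 4 ^ k\<close>. \<open>Gconst k\<close> is
  the reciprocal of the product.\<close>

lemma distr_lborel_isometry:
  fixes f :: "'a::euclidean_space \<Rightarrow> 'b::euclidean_space" and p :: "'b \<Rightarrow> 'a"
  assumes [measurable]: "f \<in> borel_measurable borel"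
    and p: "bij_betw p Basis Basis" and f: "\<And>x b. b \<in> Basis \<Longrightarrow> f x \<bullet> b = x \<bullet> p b"
  shows "distr lborel borel f = lborel"
proof (rule lborel_eqI[symmetric])
  fix l u :: 'b assume le: "\<And>b. b \<in> Basis \<Longrightarrow> l \<bullet> b \<le> u \<bullet> b"
  \<comment> \<open>\<open>T\<close> carries the corners of a box to the corners of its preimage
    under \<open>f\<close>. As \<open>p\<close> is a bijection of bases, both boxes have the same
    side lengths, and Lebesgue measure is determined by its values on boxes.\<close>
  define T :: "'b \<Rightarrow> 'a" where "T v = (\<Sum>b\<in>Basis. (v \<bullet> b) *\<^sub>R p b)" for v
  have T: "T v \<bullet> p b = v \<bullet> b" if "b \<in> Basis" for v b
  proof -
    have "T v \<bullet> p b = (\<Sum>b'\<in>Basis. (v \<bullet> b') * (p b' \<bullet> p b))"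
      by (simp add: T_def inner_sum_left)
    also have "\<dots> = (\<Sum>b'\<in>Basis. if b' = b then v \<bullet> b' else 0)"
    proof (rule sum.cong[OF refl])
      fix b' :: 'b assume "b' \<in> Basis"
      then show "v \<bullet> b' * (p b' \<bullet> p b) = (if b' = b then v \<bullet> b' else 0)"
        using that bij_betwE[OF p] bij_betw_imp_inj_on[OF p] by (simp add: inner_Basis inj_on_eq_iff)
    qed
    finally show ?thesis using that by simp
  qed
  have B: "Basis = p ` Basis" using p by (simp add: bij_betw_def)
  have eq: "f -` box l u = box (T l) (T u)"
    by (simp add: set_eq_iff box_def f, subst B, simp add: T)
  have le': "\<And>b. b \<in> Basis \<Longrightarrow> T l \<bullet> b \<le> T u \<bullet> b"
    by (subst (asm) B) (auto simp: T le)
  have "emeasure (distr lborel borel f) (box l u) = (\<Prod>b\<in>Basis. (T u - T l) \<bullet> b)"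
    using le' by (simp add: emeasure_distr eq)
  also have "\<dots> = (\<Prod>b\<in>Basis. (u - l) \<bullet> b)"
    by (subst prod.reindex_bij_betw[OF p, symmetric]) (simp add: inner_diff_left T)
  finally show "emeasure (distr lborel borel f) (box l u) = ennreal (\<Prod>b\<in>Basis. (u - l) \<bullet> b)" .
qed simp

section \<open>Pairs of reals, plane vectors and complex numbers\<close>

definition pair_of_vec :: "real^2 \<Rightarrow> real \<times> real" where
  "pair_of_vec x = (x$1, x$2)"

definition complex_of_vec :: "real^2 \<Rightarrow> complex" where
  "complex_of_vec x = Complex (x$1) (x$2)"

definition vec_of_pair :: "real \<times> real \<Rightarrow> real^2" where
  "vec_of_pair x = vector [fst x, snd x]"

definition vec_of_complex :: "complex \<Rightarrow> real^2" where
  "vec_of_complex z = vector [Re z, Im z]"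

lemma vec_inverses [simp]:
  "pair_of_vec (vec_of_pair x) = x" "vec_of_pair (pair_of_vec v) = v"
  "complex_of_vec (vec_of_complex z) = z" "vec_of_complex (complex_of_vec v) = v"
  by (simp_all add: pair_of_vec_def vec_of_pair_def complex_of_vec_def vec_of_complex_def
      vec_eq_iff forall_2 complex_eq_iff)

lemma bounded_linear_vec:
  "bounded_linear pair_of_vec" "bounded_linear complex_of_vec"
  "bounded_linear vec_of_pair" "bounded_linear vec_of_complex"
proof -
  have "linear pair_of_vec" "linear complex_of_vec" "linear vec_of_pair" "linear vec_of_complex"
    by (auto intro!: linearI simp: pair_of_vec_def vec_of_pair_def complex_of_vec_def
        vec_of_complex_def vec_eq_iff forall_2 complex_eq_iff)
  then show "bounded_linear pair_of_vec" "bounded_linear complex_of_vec"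
    "bounded_linear vec_of_pair" "bounded_linear vec_of_complex"
    by (auto intro: linear_conv_bounded_linear[THEN iffD1])
qed

lemma measurable_vec [measurable]:
  "pair_of_vec \<in> borel_measurable borel" "complex_of_vec \<in> borel_measurable borel"
  "vec_of_pair \<in> borel_measurable borel" "vec_of_complex \<in> borel_measurable borel"
  using bounded_linear_vec
  by (auto intro!: borel_measurable_continuous_onI linear_continuous_on)

lemma Basis_real_2: "(Basis :: (real^2) set) = {axis 1 1, axis 2 1}"
  by (auto simp: Basis_vec_def UNIV_2)

lemma axis_1_2_neq: "axis 1 (1::real) \<noteq> (axis 2 1 :: real^2)"
  by (simp add: axis_eq_axis)

lemma distr_pair_of_vec: "distr lborel borel pair_of_vec = lborel"
proof (rule distr_lborel_isometry[where p="\<lambda>b. if b = (1,0) then axis 1 1 else axis 2 1"])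
  show "bij_betw (\<lambda>b. if b = (1,0) then axis 1 1 else axis 2 1) (Basis::(real\<times>real) set) (Basis::(real^2) set)"
    using axis_1_2_neq axis_1_2_neq[symmetric] by (auto simp: bij_betw_def Basis_prod_def Basis_real_2 inj_on_def)
qed (auto simp: Basis_prod_def pair_of_vec_def inner_axis)

lemma distr_complex_of_vec: "distr lborel borel complex_of_vec = lborel"
proof (rule distr_lborel_isometry[where p="\<lambda>b. if b = 1 then axis 1 1 else axis 2 1"])
  show "bij_betw (\<lambda>b. if b = 1 then axis 1 1 else axis 2 1) (Basis::complex set) (Basis::(real^2) set)"
    using axis_1_2_neq axis_1_2_neq[symmetric] by (auto simp: bij_betw_def Basis_complex_def Basis_real_2 inj_on_def)
qed (auto simp: Basis_complex_def complex_of_vec_def inner_axis)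

text \<open>\<open>has_measure_differentiable_image\<close> is an equivalence between a finite
  measure of the image and a finite integral of the Jacobian. Used in both directions it also
  settles the infinite case: neither side can be finite alone.\<close>

lemma emeasure_differentiable_image:
  fixes f :: "real^'n::{finite,wellorder} \<Rightarrow> real^'n::_"
  assumes S: "S \<in> sets borel" and fS: "f ` S \<in> sets borel"
    and der: "\<And>x. x \<in> S \<Longrightarrow> (f has_derivative f' x) (at x within S)"
    and inj: "inj_on f S"
    and meas: "(\<lambda>x. indicator S x * \<bar>det (matrix (f' x))\<bar>) \<in> borel_measurable borel"
  shows "emeasure lborel (f ` S) = (\<integral>\<^sup>+x. ennreal (indicator S x * \<bar>det (matrix (f' x))\<bar>) \<partial>lborel)"
proof -
  let ?h = "\<lambda>x. indicator S x * \<bar>det (matrix (f' x))\<bar>"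
  have S': "S \<in> sets lebesgue" using S by simp
  have key: "f ` S \<in> lmeasurable \<and> measure lebesgue (f ` S) = m \<longleftrightarrow>
      integral\<^sup>N lborel ?h = ennreal m \<and> 0 \<le> m" for m
  proof -
    have "((\<lambda>x. \<bar>det (matrix (f' x))\<bar>) has_integral m) S \<longleftrightarrow> (?h has_integral m) UNIV"
    proof -
      have "?h = (\<lambda>x. if x \<in> S then \<bar>det (matrix (f' x))\<bar> else 0)"
        by (auto simp: indicator_def)
      then show ?thesis
        by (simp only: has_integral_restrict_UNIV)
    qed
    also have "\<dots> \<longleftrightarrow> integral\<^sup>N lborel ?h = ennreal m \<and> 0 \<le> m"
      using meas by (subst has_integral_iff_nn_integral_lebesgue)
        (auto simp: nn_integral_completion measurable_completion)
    finally show ?thesis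
      using has_measure_differentiable_image[OF S' der inj, of m] by simp
  qed
  show ?thesis
  proof (cases "f ` S \<in> lmeasurable")
    case True
    then have "emeasure lborel (f ` S) = ennreal (measure lebesgue (f ` S))"
    proof -
      have "emeasure lebesgue (f ` S) = ennreal (measure lebesgue (f ` S))"
        by (rule emeasure_eq_ennreal_measure) (use fmeasurableD2[OF True] in \<open>auto simp: top_unique\<close>)
      moreover have "emeasure lebesgue (f ` S) = emeasure lborel (f ` S)"
        using fS by (simp add: emeasure_completion main_part_sets)
      ultimately show ?thesis by simp
    qed
    moreover have "integral\<^sup>N lborel ?h = ennreal (measure lebesgue (f ` S))"
      using iffD1[OF key] True by blast
    ultimately show ?thesis by (simp only:)
  next
    case False
    then have "emeasure lborel (f ` S) = \<infinity>"
      using fS by (auto simp: fmeasurable_def less_top[symmetric])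
    moreover have "integral\<^sup>N lborel ?h = \<infinity>"
    proof (rule ccontr)
      assume "integral\<^sup>N lborel ?h \<noteq> \<infinity>"
      then obtain m where "integral\<^sup>N lborel ?h = ennreal m" "0 \<le> m"
        by (cases "integral\<^sup>N lborel ?h") auto
      with key False show False by blast
    qed
    ultimately show ?thesis by simp
  qed
qed

text \<open>The Jacobian of \<open>g\<close> appears as \<open>Im (cnj g\<^sub>1 * g\<^sub>2)\<close>, where \<open>g\<^sub>1\<close> and \<open>g\<^sub>2\<close> are the partial derivatives.\<close>

lemma distr_change_of_variables_complex:
  fixes g :: "real \<times> real \<Rightarrow> complex" and J :: "real \<times> real \<Rightarrow> real"
  assumes S: "S \<in> sets borel" and gS: "g ` S \<in> sets borel"
    and g [measurable]: "g \<in> borel_measurable borel"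
    and der: "\<And>x. x \<in> S \<Longrightarrow> (g has_derivative g' x) (at x within S)"
    and inj: "inj_on g S"
    and J: "\<And>x. x \<in> S \<Longrightarrow> \<bar>Im (cnj (g' x (1,0)) * g' x (0,1))\<bar> = J x"
    and Jm [measurable]: "J \<in> borel_measurable borel"
  shows "distr (density lborel (\<lambda>x. ennreal (indicator S x * J x))) borel g = density lborel (indicator (g ` S))"
    (is "?M = ?N")
proof (rule measure_eqI)
  note S [measurable] gS [measurable]
  show "sets ?M = sets ?N" by simp
  fix A assume "A \<in> sets ?M"
  then have A [measurable]: "A \<in> sets borel" by simp
  let ?T = "pair_of_vec -` (S \<inter> g -` A)"
  let ?F = "\<lambda>v. vec_of_complex (g (pair_of_vec v))"
  let ?F' = "\<lambda>v. vec_of_complex \<circ> g' (pair_of_vec v) \<circ> pair_of_vec"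
  have SA: "S \<inter> g -` A \<in> sets borel"
    using measurable_sets[OF g A] by (auto intro: sets.Int S)
  have T: "?T \<in> sets borel"
    using measurable_sets[OF measurable_vec(1) SA] by simp
  have im: "?F ` ?T = complex_of_vec -` (g ` S \<inter> A)"
  proof (intro set_eqI iffI)
    fix v assume "v \<in> complex_of_vec -` (g ` S \<inter> A)"
    then obtain x where "x \<in> S" "complex_of_vec v = g x" "g x \<in> A" by auto
    then show "v \<in> ?F ` ?T"
      by (intro image_eqI[of _ _ "vec_of_pair x"]) (auto, metis vec_inverses(4))
  qed auto
  have "g ` S \<inter> A \<in> sets borel" by measurable
  then have FT: "?F ` ?T \<in> sets borel"
    unfolding im using measurable_sets[OF measurable_vec(2)] by simp
  have der': "(?F has_derivative ?F' v) (at v within ?T)" if "v \<in> ?T" for v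
  proof -
    have "(g \<circ> pair_of_vec has_derivative g' (pair_of_vec v) \<circ> pair_of_vec) (at v within ?T)"
      by (rule diff_chain_within[OF bounded_linear_imp_has_derivative[OF bounded_linear_vec(1)]])
        (use that in \<open>auto intro!: has_derivative_subset[OF der]\<close>)
    from bounded_linear.has_derivative[OF bounded_linear_vec(4) this] show ?thesis
      by (simp add: o_def)
  qed
  have inj': "inj_on ?F ?T"
    by (intro inj_onI) (metis IntD1 inj inj_onD vec_inverses(2,3) vimageD)
  have det: "\<bar>det (matrix (?F' v))\<bar> = J (pair_of_vec v)" if "v \<in> ?T" for v
    using J[of "pair_of_vec v"] that
    by (simp add: det_2 matrix_def vec_of_complex_def pair_of_vec_def axis_def algebra_simps)
  have ind: "indicator ?T v * \<bar>det (matrix (?F' v))\<bar> = indicator (S \<inter> g -` A) (pair_of_vec v) * J (pair_of_vec v)" for v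
    using det[of v] by (auto simp: indicator_def)
  have "emeasure ?N A = emeasure lborel (g ` S \<inter> A)"
    by (simp add: emeasure_density indicator_inter_arith[symmetric])
  also have "\<dots> = emeasure (distr lborel borel complex_of_vec) (g ` S \<inter> A)"
    by (simp add: distr_complex_of_vec)
  also have "\<dots> = emeasure lborel (?F ` ?T)"
    by (subst emeasure_distr) (use \<open>g ` S \<inter> A \<in> sets borel\<close> in \<open>simp_all only: im, simp_all\<close>)
  also have "\<dots> = (\<integral>\<^sup>+v. ennreal (indicator ?T v * \<bar>det (matrix (?F' v))\<bar>) \<partial>lborel)"
    by (rule emeasure_differentiable_image[OF T FT der' inj']) (simp_all only: ind, use SA in measurable)
  also have "\<dots> = (\<integral>\<^sup>+v. ennreal (indicator (S \<inter> g -` A) (pair_of_vec v) * J (pair_of_vec v)) \<partial>lborel)"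
    by (simp only: ind)
  also have "\<dots> = (\<integral>\<^sup>+x. ennreal (indicator (S \<inter> g -` A) x * J x) \<partial>distr lborel borel pair_of_vec)"
    by (subst nn_integral_distr) (use SA in \<open>auto intro!: measurable_compose[OF _ measurable_ennreal]\<close>)
  also have "\<dots> = (\<integral>\<^sup>+x. ennreal (indicator S x * J x) * indicator (g -` A) x \<partial>lborel)"
    by (simp only: distr_pair_of_vec) (auto intro!: nn_integral_cong simp: indicator_def)
  also have "\<dots> = emeasure ?M A"
    using measurable_sets[OF g A] by (simp add: emeasure_distr emeasure_density)
  finally show "emeasure ?M A = emeasure ?N A" ..
qed

lemma nn_integral_change_of_variables_complex:
  fixes g :: "real \<times> real \<Rightarrow> complex" and J :: "real \<times> real \<Rightarrow> real"
  assumes S: "S \<in> sets borel" and gS: "g ` S \<in> sets borel"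
    and g [measurable]: "g \<in> borel_measurable borel"
    and der: "\<And>x. x \<in> S \<Longrightarrow> (g has_derivative g' x) (at x within S)"
    and inj: "inj_on g S"
    and J: "\<And>x. x \<in> S \<Longrightarrow> \<bar>Im (cnj (g' x (1,0)) * g' x (0,1))\<bar> = J x"
    and Jm [measurable]: "J \<in> borel_measurable borel"
    and f [measurable]: "f \<in> borel_measurable borel"
  shows "(\<integral>\<^sup>+x. ennreal (indicator S x * J x) * f (g x) \<partial>lborel) = (\<integral>\<^sup>+z. f z * indicator (g ` S) z \<partial>lborel)"
proof -
  note S [measurable] gS [measurable]
  have "integral\<^sup>N (distr (density lborel (\<lambda>x. ennreal (indicator S x * J x))) borel g) f =
      integral\<^sup>N (density lborel (indicator (g ` S))) f"
    using distr_change_of_variables_complex[OF S gS g der inj J Jm] by simp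
  then show ?thesis
    by (simp add: nn_integral_distr nn_integral_density mult.commute)
qed

lemma integral_change_of_variables_complex:
  fixes g :: "real \<times> real \<Rightarrow> complex" and J :: "real \<times> real \<Rightarrow> real"
    and f :: "complex \<Rightarrow> 'a::{banach, second_countable_topology}"
  assumes S: "S \<in> sets borel" and gS: "g ` S \<in> sets borel"
    and g [measurable]: "g \<in> borel_measurable borel"
    and der: "\<And>x. x \<in> S \<Longrightarrow> (g has_derivative g' x) (at x within S)"
    and inj: "inj_on g S"
    and J: "\<And>x. x \<in> S \<Longrightarrow> \<bar>Im (cnj (g' x (1,0)) * g' x (0,1))\<bar> = J x"
    and Jm [measurable]: "J \<in> borel_measurable borel"
    and f [measurable]: "f \<in> borel_measurable borel"
  shows "set_integrable lborel S (\<lambda>x. J x *\<^sub>R f (g x)) \<longleftrightarrow> set_integrable lborel (g ` S) f"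
    and "(LINT x:S|lborel. J x *\<^sub>R f (g x)) = (LINT z:g ` S|lborel. f z)"
proof -
  note S [measurable] gS [measurable]
  let ?M = "density lborel (\<lambda>x. ennreal (indicator S x * J x))"
  have eq: "distr ?M borel g = density lborel (\<lambda>z. ennreal (indicator (g ` S) z))"
    using distr_change_of_variables_complex[OF S gS g der inj J Jm] by (simp add: ennreal_indicator)
  \<comment> \<open>Off \<open>S\<close> the indicator removes \<open>J\<close>; on \<open>S\<close>
    the hypothesis makes \<open>J\<close> an absolute value.\<close>
  have nonneg: "indicator S x * J x \<ge> 0" for x
    using J[of x] by (auto simp: indicator_def)
  have "set_integrable lborel S (\<lambda>x. J x *\<^sub>R f (g x)) \<longleftrightarrow> integrable ?M (\<lambda>x. f (g x))"
    by (subst integrable_density) (auto simp: nonneg set_integrable_def)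
  also have "\<dots> \<longleftrightarrow> integrable (distr ?M borel g) f"
    by (subst integrable_distr_eq) auto
  also have "\<dots> \<longleftrightarrow> set_integrable lborel (g ` S) f"
    unfolding eq by (subst integrable_density) (auto simp: set_integrable_def)
  finally show "set_integrable lborel S (\<lambda>x. J x *\<^sub>R f (g x)) \<longleftrightarrow> set_integrable lborel (g ` S) f" .
  have "(LINT x:S|lborel. J x *\<^sub>R f (g x)) = integral\<^sup>L ?M (\<lambda>x. f (g x))"
    by (subst integral_density) (auto simp: nonneg set_lebesgue_integral_def)
  also have "\<dots> = integral\<^sup>L (distr ?M borel g) f"
    by (subst integral_distr) auto
  also have "\<dots> = (LINT z:g ` S|lborel. f z)"
    unfolding eq by (subst integral_density) (auto simp: set_lebesgue_integral_def)
  finally show "(LINT x:S|lborel. J x *\<^sub>R f (g x)) = (LINT z:g ` S|lborel. f z)" .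
qed

subsection \<open>Geodesics in fan-beam coordinates\<close>

text \<open>The value of \<open>(cis b + z) / (cis b - z)\<close> at \<open>z = geod b a t\<close>: in this right half-plane the geodesics
  issuing from \<open>cis b\<close> become horizontal rays.\<close>

definition halfplane_coord :: "real \<Rightarrow> real \<Rightarrow> complex" where
  "halfplane_coord a t = complex_of_real (exp (- t)) - \<i> * complex_of_real a"

text \<open>The Poisson kernel of the disk with pole \<open>cis b\<close>, without the factor
  \<open>1 / (2 * pi)\<close>. It equals \<open>exp (- t)\<close> along geodesics issuing from
  \<open>cis b\<close>, so it also serves as time coordinate.\<close>

definition poisson :: "real \<Rightarrow> complex \<Rightarrow> real" where
  "poisson b z = (1 - (cmod z)\<^sup>2) / (cmod (cis b - z))\<^sup>2"

text \<open>The parameter \<open>a\<close> of the geodesic from \<open>cis b\<close> through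
  \<open>z\<close>; the sign undoes \<open>Im (halfplane_coord a t) = - a\<close>.\<close>

definition fan_coord :: "real \<Rightarrow> complex \<Rightarrow> real" where
  "fan_coord b z = - Im ((cis b + z) / (cis b - z))"

text \<open>For \<open>z\<close> in the disk, the Euclidean unit tangent at \<open>z\<close> of the
  geodesic issuing from \<open>cis b\<close>.\<close>

definition direction :: "real \<Rightarrow> complex \<Rightarrow> complex" where
  "direction b z = (z - cis b) / (1 - cnj z * cis b)"

lemma cis_neq_ball: "cmod z < 1 \<Longrightarrow> cis b \<noteq> z"
  by auto

lemma poisson_eq_Re: "poisson b z = Re ((cis b + z) / (cis b - z))"
proof (cases "cis b = z")
  case False
  have "Re ((cis b + z) / (cis b - z)) = Re ((cis b + z) * cnj (cis b - z)) / (cmod (cis b - z))\<^sup>2"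
    by (subst complex_div_cnj) (simp only: of_real_power[symmetric] Re_divide_of_real)
  also have "Re ((cis b + z) * cnj (cis b - z)) = (cmod (cis b))\<^sup>2 - (cmod z)\<^sup>2"
    unfolding cmod_power2 by (simp add: power2_eq_square algebra_simps)
  finally show ?thesis by (simp add: poisson_def)
qed (simp add: poisson_def)

lemma poisson_pos: "cmod z < 1 \<Longrightarrow> poisson b z > 0"
  using cis_neq_ball[of z b] by (auto simp: poisson_def power_less_one_iff intro!: divide_pos_pos)

lemma Re_halfplane_coord [simp]: "Re (halfplane_coord a t) = exp (- t)" and Im_halfplane_coord [simp]: "Im (halfplane_coord a t) = - a"
  by (simp_all add: halfplane_coord_def)

lemma halfplane_coord_plus_1_nz: "halfplane_coord a t + 1 \<noteq> 0"
proof
  assume "halfplane_coord a t + 1 = 0"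
  then have "Re (halfplane_coord a t + 1) = 0" by simp
  then show False using exp_gt_zero[of "-t"] by (simp del: exp_gt_zero)
qed

text \<open>With \<open>q = exp (- t)\<close> one has \<open>tanh (t/2) = (1 - q) / (1 + q)\<close>;
  numerator and denominator of \<open>geod\<close> then share the factor
  \<open>- 2 / (1 + q)\<close>, and a rotated Cayley transform of \<open>q - \<i> * a\<close>
  remains.\<close>

lemma geod_eq: "geod b a t = cis b * ((halfplane_coord a t - 1) / (halfplane_coord a t + 1))"
proof -
  define q where "q = complex_of_real (exp (- t))"
  have q1: "1 + q \<noteq> 0"
  proof
    assume "1 + q = 0"
    then have "Re (1 + q) = 0" by simp
    then show False using exp_gt_zero[of "-t"] by (simp add: q_def del: exp_gt_zero)
  qed
  have T: "complex_of_real (tanh (t/2)) = (1 - q) / (1 + q)"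
    by (simp add: tanh_real_altdef q_def)
  have h: "halfplane_coord a t = q - \<i> * a" by (simp add: halfplane_coord_def q_def)
  have nz: "q - \<i> * a + 1 \<noteq> 0" using halfplane_coord_plus_1_nz[of a t] h by simp
  have num: "(2 + \<i> * a) * ((1 - q) / (1 + q)) + \<i> * a = - 2 * (q - \<i> * a - 1) / (1 + q)"
    using q1 by (simp add: field_simps)
  have den: "\<i> * a * ((1 - q) / (1 + q)) - 2 + \<i> * a = - 2 * (q - \<i> * a + 1) / (1 + q)"
    using q1 by (simp add: field_simps)
  show ?thesis
  proof -
    have "(- 2 * x / (1 + q)) / (- 2 * y / (1 + q)) = x / y" for x y :: complex
      using q1 by simp
    then show ?thesis
      unfolding geod_def T num den h by (simp only: cis_conv_exp)
  qed
qed

lemma geod_inverse: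
  "(cis b + geod b a t) / (cis b - geod b a t) = halfplane_coord a t"
proof -
  have "cis b + geod b a t = 2 * cis b * halfplane_coord a t / (halfplane_coord a t + 1)"
    "cis b - geod b a t = 2 * cis b / (halfplane_coord a t + 1)"
    using halfplane_coord_plus_1_nz[of a t] by (simp_all add: geod_eq field_simps)
  then show ?thesis using halfplane_coord_plus_1_nz[of a t] by simp
qed

lemma geod_surj:
  assumes "cmod z < 1"
  shows "geod b (fan_coord b z) (- ln (poisson b z)) = z"
proof -
  have "halfplane_coord (fan_coord b z) (- ln (poisson b z)) = (cis b + z) / (cis b - z)"
    using poisson_pos[OF assms, of b] by (simp add: complex_eq_iff fan_coord_def poisson_eq_Re)
  moreover have "(cis b + z) / (cis b - z) - 1 = 2 * z / (cis b - z)"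
    "(cis b + z) / (cis b - z) + 1 = 2 * cis b / (cis b - z)"
    using cis_neq_ball[OF assms, of b] by (simp_all add: field_simps)
  ultimately show ?thesis
    using cis_neq_ball[OF assms, of b] by (simp add: geod_eq)
qed

text \<open>Under the Cayley transform the defect \<open>1 - |z|^2\<close> becomes
  \<open>(|h + 1|^2 - |h - 1|^2) / |h + 1|^2\<close>, whose numerator is
  \<open>4 * Re h\<close>.\<close>

lemma cfac_geod: "cfac (geod b a t) = 2 * exp (- t) / (cmod (halfplane_coord a t + 1))\<^sup>2"
proof -
  have nz: "(cmod (halfplane_coord a t + 1))\<^sup>2 \<noteq> 0" using halfplane_coord_plus_1_nz by simp
  have "(cmod (geod b a t))\<^sup>2 = (cmod (halfplane_coord a t - 1))\<^sup>2 / (cmod (halfplane_coord a t + 1))\<^sup>2"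
    by (simp add: geod_eq norm_mult norm_divide power_divide)
  also have "\<dots> = 1 - 4 * exp (- t) / (cmod (halfplane_coord a t + 1))\<^sup>2"
  proof -
    have "(cmod (halfplane_coord a t - 1))\<^sup>2 = (cmod (halfplane_coord a t + 1))\<^sup>2 - 4 * exp (- t)"
      unfolding cmod_power2 by (simp add: power2_eq_square algebra_simps)
    then show ?thesis using nz by (simp add: diff_divide_distrib)
  qed
  finally show ?thesis by (simp add: cfac_def)
qed

lemma cfac_pos_iff: "cfac z > 0 \<longleftrightarrow> cmod z < 1"
  by (simp add: cfac_def power_less_one_iff)

lemma geod_in_ball: "cmod (geod b a t) < 1"
  using halfplane_coord_plus_1_nz by (simp add: cfac_pos_iff[symmetric] cfac_geod)

lemma fan_coord_geod [simp]: "fan_coord b (geod b a t) = a"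
  by (simp add: fan_coord_def geod_inverse)

lemma poisson_geod [simp]: "poisson b (geod b a t) = exp (- t)"
  by (simp add: poisson_eq_Re geod_inverse)

lemma has_derivative_geod:
  "((\<lambda>x. geod b (fst x) (snd x)) has_derivative
     (\<lambda>v. 2 * cis b / (halfplane_coord (fst x) (snd x) + 1)\<^sup>2 * (complex_of_real (- exp (- snd x) * snd v) - \<i> * complex_of_real (fst v)))) (at x within S)"
proof -
  have h: "((\<lambda>x. halfplane_coord (fst x) (snd x)) has_derivative (\<lambda>v. complex_of_real (- exp (- snd x) * snd v) - \<i> * complex_of_real (fst v))) (at x within S)"
    unfolding halfplane_coord_def by (auto intro!: derivative_eq_intros simp: fun_eq_iff)
  have "((\<lambda>w. cis b * ((w - 1) / (w + 1))) has_field_derivative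
      2 * cis b / (halfplane_coord (fst x) (snd x) + 1)\<^sup>2) (at (halfplane_coord (fst x) (snd x)))"
    using halfplane_coord_plus_1_nz[of "fst x" "snd x"]
    by (auto intro!: derivative_eq_intros simp: power2_eq_square algebra_simps)
  from has_derivative_compose[OF h this[unfolded has_field_derivative_def]]
  show ?thesis by (simp add: geod_eq)
qed

lemma direction_geod: "direction b (geod b a t) = - cis b * (cnj (halfplane_coord a t) + 1) / (halfplane_coord a t + 1)"
proof -
  let ?h = "halfplane_coord a t"
  have nz: "?h + 1 \<noteq> 0" by (rule halfplane_coord_plus_1_nz)
  then have nz': "cnj ?h + 1 \<noteq> 0"
    by (metis complex_cnj_add complex_cnj_one complex_cnj_zero_iff)
  have "geod b a t - cis b = - 2 * cis b / (?h + 1)"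
    using nz by (simp add: geod_eq field_simps)
  moreover have "cnj (geod b a t) * cis b = (cnj ?h - 1) / (cnj ?h + 1)"
    by (simp add: geod_eq cis_cnj cis_mult mult.commute mult.left_commute flip: cis_inverse)
  then have "1 - cnj (geod b a t) * cis b = 2 / (cnj ?h + 1)"
    using nz' by (simp add: field_simps)
  ultimately have "direction b (geod b a t) = (- 2 * cis b / (?h + 1)) / (2 / (cnj ?h + 1))"
    by (simp only: direction_def)
  also have "\<dots> = - cis b * (cnj ?h + 1) / (?h + 1)"
  proof -
    have "(- 2 * e / x) / (2 / y) = - e * y / x" if "x \<noteq> 0" "y \<noteq> 0" for e x y :: complex
      using that by (simp add: field_simps)
    then show ?thesis using nz nz' by blast
  qed
  finally show ?thesis .
qed

text \<open>This is hyperbolic unit speed. A component of order \<open>m\<close> evaluated on the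
  velocity thereby becomes a scalar \<open>h z * cfac z ^ m\<close> times a power of the direction
  or of its conjugate.\<close>

lemma geod_vel_eq: "geod_vel b a t = cfac (geod b a t) * direction b (geod b a t)"
proof -
  let ?h = "halfplane_coord a t"
  have nz: "?h + 1 \<noteq> 0" by (rule halfplane_coord_plus_1_nz)
  then have nz': "cnj ?h + 1 \<noteq> 0"
    by (metis complex_cnj_add complex_cnj_one complex_cnj_zero_iff)
  have pair: "((\<lambda>t. (a,t)) has_derivative (\<lambda>s. (0,s))) (at t)"
    by (auto intro!: derivative_eq_intros)
  have "((\<lambda>t. geod b a t) has_derivative
     (\<lambda>s. 2 * cis b / (?h + 1)\<^sup>2 * complex_of_real (- exp (- t) * s))) (at t)"
    using has_derivative_compose[OF pair has_derivative_geod[of b "(a,t)" UNIV]]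
    by simp
  then have "((geod b a) has_derivative (\<lambda>s. s *\<^sub>R (- 2 * cis b * complex_of_real (exp (- t)) / (?h + 1)\<^sup>2))) (at t)"
    by (simp add: scaleR_conv_of_real mult_ac)
  then have "geod_vel b a t = - 2 * cis b * complex_of_real (exp (- t)) / (?h + 1)\<^sup>2"
    by (simp add: geod_vel_def vector_derivative_at has_vector_derivative_def)
  moreover have "complex_of_real ((cmod (?h + 1))\<^sup>2) = (?h + 1) * (cnj ?h + 1)"
    by (simp only: complex_norm_square) simp
  then have "complex_of_real (cfac (geod b a t)) = 2 * complex_of_real (exp (- t)) / ((?h + 1) * (cnj ?h + 1))"
    by (simp only: cfac_geod of_real_divide of_real_mult of_real_numeral)
  moreover have "- 2 * e * q / x\<^sup>2 = (2 * q / (x * y)) * (- e * y / x)" if "x \<noteq> 0" "y \<noteq> 0" for e q x y :: complex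
    using that by (simp add: field_simps power2_eq_square)
  ultimately show ?thesis
    using nz nz' by (simp only: direction_geod) blast
qed

section \<open>Measurability rules for the geometric maps\<close>

lemma measurable_cis [measurable (raw)]:
  "f \<in> borel_measurable M \<Longrightarrow> (\<lambda>x. cis (f x)) \<in> borel_measurable M"
  by (rule measurable_compose) (auto intro!: borel_measurable_continuous_onI continuous_intros)

lemma measurable_cnj [measurable (raw)]:
  "f \<in> borel_measurable M \<Longrightarrow> (\<lambda>x. cnj (f x)) \<in> borel_measurable M"
  by (rule measurable_compose) (auto intro!: borel_measurable_continuous_onI continuous_intros)

lemma measurable_fst_snd_borel [measurable (raw)]:
  fixes f :: "'a \<Rightarrow> 'b::second_countable_topology \<times> 'c::second_countable_topology"
  assumes [measurable]: "f \<in> borel_measurable M"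
  shows "(\<lambda>x. fst (f x)) \<in> borel_measurable M" "(\<lambda>x. snd (f x)) \<in> borel_measurable M"
proof -
  have [measurable]: "f \<in> M \<rightarrow>\<^sub>M borel \<Otimes>\<^sub>M borel" by (simp add: borel_prod)
  show "(\<lambda>x. fst (f x)) \<in> borel_measurable M" "(\<lambda>x. snd (f x)) \<in> borel_measurable M"
    by measurable
qed

lemma ball_in_sets_borel [measurable]: "ball (z :: 'a::metric_space) r \<in> sets borel"
  by simp

lemma measurable_cfac [measurable (raw)]:
  assumes [measurable]: "f \<in> borel_measurable M"
  shows "(\<lambda>x. cfac (f x)) \<in> borel_measurable M"
  unfolding cfac_def by measurable

lemma measurable_bdf [measurable (raw)]:
  assumes [measurable]: "f \<in> borel_measurable M"
  shows "(\<lambda>x. bdf (f x)) \<in> borel_measurable M"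
  unfolding bdf_def by measurable

lemma measurable_poisson [measurable (raw)]:
  assumes [measurable]: "f \<in> borel_measurable M" "g \<in> borel_measurable M"
  shows "(\<lambda>x. poisson (f x) (g x)) \<in> borel_measurable M"
  unfolding poisson_def by measurable

lemma measurable_fan_coord [measurable (raw)]:
  assumes [measurable]: "f \<in> borel_measurable M" "g \<in> borel_measurable M"
  shows "(\<lambda>x. fan_coord (f x) (g x)) \<in> borel_measurable M"
  unfolding fan_coord_def by measurable

lemma measurable_direction [measurable (raw)]:
  assumes [measurable]: "f \<in> borel_measurable M" "g \<in> borel_measurable M"
  shows "(\<lambda>x. direction (f x) (g x)) \<in> borel_measurable M"
  unfolding direction_def by measurable

lemma measurable_geod [measurable (raw)]:
  assumes [measurable]: "f \<in> borel_measurable M" "g \<in> borel_measurable M" "h \<in> borel_measurable M"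
  shows "(\<lambda>x. geod (f x) (g x) (h x)) \<in> borel_measurable M"
  unfolding geod_eq halfplane_coord_def by measurable

text \<open>Geodesics issuing from the boundary point \<open>cis b\<close> foliate the disk, and the Poisson kernel is
  the density of \<open>da dt\<close> with respect to the hyperbolic area.\<close>

lemma nn_integral_geod:
  assumes [measurable]: "f \<in> borel_measurable borel"
  shows "(\<integral>\<^sup>+x. f (geod b (fst x) (snd x)) \<partial>lborel) =
    (\<integral>\<^sup>+z. f z * ennreal (indicator (ball 0 1) z * (poisson b z / (cfac z)\<^sup>2)) \<partial>lborel)"
proof -
  let ?g = "\<lambda>x. geod b (fst x) (snd x)"
  \<comment> \<open>The Jacobian in \<open>(a, t)\<close> is
    \<open>|2 / (h + 1)^2|^2 * exp (- t)\<close>; the formulas for \<open>cfac\<close> and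
    \<open>poisson\<close> along a geodesic turn it into a function of the point alone.\<close>
  let ?J = "\<lambda>x. (cfac (?g x))\<^sup>2 / poisson b (?g x)"
  have im: "range ?g = ball 0 1"
  proof (intro equalityI subsetI)
    fix z :: complex assume "z \<in> ball 0 1"
    then show "z \<in> range ?g"
      by (intro range_eqI[of _ _ "(fan_coord b z, - ln (poisson b z))"]) (simp add: geod_surj)
  qed (auto simp: geod_in_ball)
  have inj: "inj ?g"
  proof (rule injI)
    fix x y assume eq: "?g x = ?g y"
    then have "fan_coord b (?g x) = fan_coord b (?g y)" "poisson b (?g x) = poisson b (?g y)" by simp_all
    then show "x = y" by (simp add: prod_eq_iff)
  qed
  have J: "\<bar>Im (cnj (2 * cis b / (halfplane_coord (fst x) (snd x) + 1)\<^sup>2 * (complex_of_real (- exp (- snd x) * snd ((1::real),(0::real))) - \<i> * complex_of_real (fst ((1::real),(0::real))))) *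
      (2 * cis b / (halfplane_coord (fst x) (snd x) + 1)\<^sup>2 * (complex_of_real (- exp (- snd x) * snd ((0::real),(1::real))) - \<i> * complex_of_real (fst ((0::real),(1::real))))))\<bar> = ?J x" for x
  proof -
    let ?w = "2 * cis b / (halfplane_coord (fst x) (snd x) + 1)\<^sup>2"
    have "cnj (?w * (- \<i>)) * (?w * (- complex_of_real (exp (- snd x)))) = (?w * cnj ?w) * (- (\<i> * complex_of_real (exp (- snd x))))"
    proof -
      have "cnj (w * (- \<i>)) * (w * (- q)) = (w * cnj w) * (- (\<i> * q))" for w q
        by simp
      then show ?thesis .
    qed
    also have "?w * cnj ?w = complex_of_real ((cmod ?w)\<^sup>2)"
      by (simp only: complex_norm_square)
    finally have "\<bar>Im (cnj (?w * (- \<i>)) * (?w * (- complex_of_real (exp (- snd x)))))\<bar> = (cmod ?w)\<^sup>2 * exp (- snd x)"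
      by simp
    also have "\<dots> = ?J x"
      by (simp add: cfac_geod norm_divide norm_mult norm_power power_divide power2_eq_square)
    finally show ?thesis by simp
  qed
  have "(\<integral>\<^sup>+x. f (?g x) \<partial>lborel) = (\<integral>\<^sup>+x. ennreal (indicator UNIV x * ?J x) *
      (f (?g x) * ennreal (poisson b (?g x) / (cfac (?g x))\<^sup>2)) \<partial>lborel)"
  \<comment> \<open>The integrand is multiplied and divided by the Jacobian, so that the change of
    variables applies to \<open>f\<close> times the reciprocal of \<open>?J\<close>.\<close>
  proof (rule nn_integral_cong)
    fix x
    have "?J x > 0" "poisson b (?g x) / (cfac (?g x))\<^sup>2 > 0"
      using geod_in_ball[of b "fst x" "snd x"] by (simp_all add: cfac_pos_iff[symmetric])
    moreover have "?J x * (poisson b (?g x) / (cfac (?g x))\<^sup>2) = 1"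
      using geod_in_ball[of b "fst x" "snd x"] by (simp add: cfac_pos_iff[symmetric])
    ultimately have "ennreal (?J x) * ennreal (poisson b (?g x) / (cfac (?g x))\<^sup>2) = 1"
      by (metis ennreal_1 ennreal_mult less_imp_le)
    then show "f (?g x) = ennreal (indicator UNIV x * ?J x) *
      (f (?g x) * ennreal (poisson b (?g x) / (cfac (?g x))\<^sup>2))"
      by (simp add: mult.left_commute)
  qed
  also have "\<dots> = (\<integral>\<^sup>+z. (f z * ennreal (poisson b z / (cfac z)\<^sup>2)) * indicator (range ?g) z \<partial>lborel)"
    by (rule nn_integral_change_of_variables_complex[OF _ _ _ has_derivative_geod inj J])
      (simp_all add: im)
  also have "\<dots> = (\<integral>\<^sup>+z. f z * ennreal (indicator (ball 0 1) z * (poisson b z / (cfac z)\<^sup>2)) \<partial>lborel)"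
    by (auto intro!: nn_integral_cong simp: im indicator_def)
  finally show ?thesis .
qed

subsection \<open>Poisson integrals over the initial endpoint\<close>

text \<open>On the unit circle conjugation is inversion, so the kernel is rational in
  \<open>u = cis (- b)\<close>. Its only pole in the closed disk is
  \<open>u = cnj z\<close>.\<close>

lemma poisson_complex:
  assumes "cmod z < 1"
  shows "complex_of_real (poisson b z) = (1 - z * cnj z) * cis (- b) / ((1 - z * cis (- b)) * (cis (- b) - cnj z))"
proof -
  have E: "cis b - z \<noteq> 0" using cis_neq_ball[OF assms, of b] by simp
  have u: "cis (- b) = inverse (cis b)" by (simp add: cis_inverse)
  have "complex_of_real ((cmod (cis b - z))\<^sup>2) = (cis b - z) * (cis (- b) - cnj z)"
    by (simp only: complex_norm_square) (simp add: cis_cnj)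
  moreover have "1 - z * cis (- b) = cis (- b) * (cis b - z)"
    by (simp add: u field_simps)
  moreover have "complex_of_real (1 - (cmod z)\<^sup>2) = 1 - z * cnj z"
    by (simp add: complex_norm_square del: of_real_power)
  ultimately show ?thesis
    by (simp add: poisson_def del: of_real_power of_real_diff)
qed

lemma one_minus_mult_nz:
  assumes "cmod z < 1" "cmod u \<le> 1"
  shows "1 - z * u \<noteq> 0"
proof
  assume "1 - z * u = 0"
  then have "cmod z * cmod u = 1" by (metis eq_iff_diff_eq_0 norm_mult norm_one)
  moreover have "cmod z * cmod u \<le> cmod z * 1" using assms by (intro mult_left_mono) auto
  ultimately show False using assms by simp
qed

text \<open>Cauchy's formula at the pole \<open>cnj z\<close>, with
  \<open>(1 - z * cnj z) / (1 - z * u)\<close> absorbed into the holomorphic function; that factor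
  is 1 at the pole. The variable is \<open>cis (- b)\<close> because the fibre quantities below are
  holomorphic in the conjugated endpoint.\<close>

lemma poisson_integral:
  fixes f :: "complex \<Rightarrow> complex"
  assumes hol: "f holomorphic_on cball 0 1" and z: "cmod z < 1"
  shows "((\<lambda>b. f (cis (- b)) * poisson b z) has_integral 2 * pi * f (cnj z)) {0..2*pi}"
proof -
  let ?F = "\<lambda>u. f u * (1 - z * cnj z) / (1 - z * u)"
  note nz = one_minus_mult_nz[OF z]
  have "?F holomorphic_on cball 0 1"
    using nz by (intro holomorphic_intros hol) (auto simp: dist_norm)
  then have "((\<lambda>u. ?F u / (u - cnj z)) has_contour_integral (2 * of_real pi * \<i> * ?F (cnj z))) (circlepath 0 1)"
    by (rule Cauchy_integral_circlepath_simple) (simp add: z)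
  moreover have "?F (cnj z) = f (cnj z)"
    using nz[of "cnj z"] z by simp
  \<comment> \<open>The circle is parametrised over \<open>[- 2 * pi, 0]\<close>, so that the
    reflection \<open>t \<mapsto> - t\<close> lands exactly on \<open>{0..2*pi}\<close>.\<close>
  moreover have "circlepath 0 1 = part_circlepath 0 1 (- 2 * pi) 0"
  proof
    fix x :: real
    have "exp (\<i> * complex_of_real (2 * pi * x)) = exp (\<i> * complex_of_real (2 * pi * x - 2 * pi))"
      by (simp add: right_diff_distrib exp_diff exp_two_pi_i' mult.commute)
    then show "circlepath 0 1 x = part_circlepath 0 1 (- 2 * pi) 0 x"
      by (simp add: circlepath_def part_circlepath_def linepath_def algebra_simps)
  qed
  ultimately have "((\<lambda>t. ?F (cis t) / (cis t - cnj z) * \<i> * cis t) has_integral 2 * of_real pi * \<i> * f (cnj z)) {- (2 * pi)..-0}"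
    by (simp add: has_contour_integral_part_circlepath_iff)
  then have "((\<lambda>t. ?F (cis (- t)) / (cis (- t) - cnj z) * \<i> * cis (- t)) has_integral 2 * of_real pi * \<i> * f (cnj z)) {0..2*pi}"
    by (subst (asm) has_integral_reflect_real[symmetric]) simp
  \<comment> \<open>Multiplication by \<open>- \<i>\<close> removes the \<open>\<i>\<close> in
    \<open>du = \<i> * u * dt\<close>.\<close>
  then have "((\<lambda>t. - \<i> * (?F (cis (- t)) / (cis (- t) - cnj z) * \<i> * cis (- t))) has_integral - \<i> * (2 * of_real pi * \<i> * f (cnj z))) {0..2*pi}"
    by (rule has_integral_mult_right)
  moreover have "- \<i> * (?F (cis (- t)) / (cis (- t) - cnj z) * \<i> * cis (- t)) = f (cis (- t)) * poisson t z" for t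
    by (simp add: poisson_complex[OF z] mult_ac)
  ultimately show ?thesis by (simp add: mult_ac)
qed

text \<open>For \<open>cmod z < 1\<close> this is the disk involution exchanging \<open>0\<close>
  and \<open>cnj z\<close>. On the circle it translates between two parameters of the fibre over
  \<open>z\<close>: the conjugated initial endpoint \<open>u\<close> and the conjugated direction
  \<open>moeb z u\<close>.\<close>

definition moeb :: "complex \<Rightarrow> complex \<Rightarrow> complex" where
  "moeb z u = (cnj z - u) / (1 - z * u)"

text \<open>The Schwarz-Pick identity. It shows that the closed disk and the circle are preserved,
  and later it transforms the Bergman weight.\<close>

lemma moeb_norm_identity:
  assumes "cmod z < 1" "cmod u \<le> 1"
  shows "1 - (cmod (moeb z u))\<^sup>2 = (1 - (cmod z)\<^sup>2) * (1 - (cmod u)\<^sup>2) / (cmod (1 - z * u))\<^sup>2"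
proof -
  have nz: "(cmod (1 - z * u))\<^sup>2 \<noteq> 0" using one_minus_mult_nz[OF assms] by simp
  have "(cmod (1 - z * u))\<^sup>2 - (cmod (cnj z - u))\<^sup>2 = (1 - (cmod z)\<^sup>2) * (1 - (cmod u)\<^sup>2)"
    unfolding cmod_power2 by (simp add: power2_eq_square algebra_simps)
  then show ?thesis
    using nz by (simp add: moeb_def norm_divide power_divide field_simps)
qed

lemma moeb_norm_le:
  assumes "cmod z < 1" "cmod u \<le> 1"
  shows "cmod (moeb z u) \<le> 1"
proof -
  have "0 \<le> 1 - (cmod (moeb z u))\<^sup>2"
    unfolding moeb_norm_identity[OF assms] using assms
    by (intro divide_nonneg_nonneg mult_nonneg_nonneg) (auto simp: power_le_one)
  then show ?thesis by (simp add: power_le_one_iff abs_square_le_1)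
qed

lemma moeb_norm_eq:
  assumes "cmod z < 1" "cmod u = 1"
  shows "cmod (moeb z u) = 1"
  using moeb_norm_identity[of z u] assms norm_ge_zero[of "moeb z u"]
  by (auto simp: power2_eq_1_iff simp del: norm_ge_zero)

lemma moeb_holomorphic: "cmod z < 1 \<Longrightarrow> moeb z holomorphic_on cball 0 1"
  unfolding moeb_def using one_minus_mult_nz
  by (intro holomorphic_intros) (auto simp: dist_norm)

text \<open>Poisson integrals evaluate at \<open>u = cnj z\<close>, which is \<open>e = 0\<close> in
  the variable \<open>e = moeb z u\<close>: integration over a fibre extracts the constant term of a
  power series in \<open>e\<close>.\<close>

lemma moeb_cnj [simp]: "moeb z (cnj z) = 0"
  by (simp add: moeb_def)

lemma cnj_direction: "cnj (direction b z) = moeb z (cis (- b))"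
  by (simp add: direction_def moeb_def cis_cnj)

text \<open>The direction is unimodular, so its conjugate \<open>e\<close> is its inverse; powers of
  the direction lower the exponent of \<open>e\<close>.\<close>

lemma direction_moeb:
  assumes "cmod z < 1"
  shows "direction b z * moeb z (cis (- b)) = 1"
  using moeb_norm_eq[OF assms, of "cis (- b)"] complex_norm_square[of "direction b z"]
  by (simp add: cnj_direction[symmetric])

lemma norm_direction: "cmod z < 1 \<Longrightarrow> cmod (direction b z) = 1"
  using moeb_norm_eq[of z "cis (- b)"] by (simp add: cnj_direction[symmetric])

text \<open>\<open>\<i> * a\<close> is minus half the difference of the half-plane value and its
  conjugate, and on the circle both are rational in \<open>u\<close>.\<close>

lemma i_fan_coord:
  assumes "cmod z < 1" and u: "u = cis (- b)"
  shows "\<i> * fan_coord b z = (cnj z - u\<^sup>2 * z) / ((1 - u * z) * (u - cnj z))"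
proof -
  have E: "cis b - z \<noteq> 0" using cis_neq_ball[OF assms(1), of b] by simp
  have uE: "u * cis b = 1" by (simp add: u cis_mult)
  have 1: "1 - u * z \<noteq> 0" using one_minus_mult_nz[OF assms(1), of u] by (simp add: u mult.commute)
  have E': "cnj (cis b - z) = u - cnj z" by (simp add: u cis_cnj)
  have 2: "u - cnj z \<noteq> 0" using E by (metis E' complex_cnj_zero_iff)
  define W where "W = (cis b + z) / (cis b - z)"
  have "W = (u * (cis b + z)) / (u * (cis b - z))"
    by (simp add: W_def u)
  also have "\<dots> = (1 + u * z) / (1 - u * z)"
    by (simp add: algebra_simps uE)
  finally have W: "W = (1 + u * z) / (1 - u * z)" .
  have W': "cnj W = (u + cnj z) / (u - cnj z)"
    by (simp add: W_def E' u cis_cnj)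
  have "\<i> * fan_coord b z = - (W - cnj W) / 2"
    by (simp add: fan_coord_def W_def[symmetric] complex_diff_cnj)
  also have "\<dots> = (cnj z - u\<^sup>2 * z) / ((1 - u * z) * (u - cnj z))"
  proof -
    have "- (a / c - a' / c') / 2 = (a' * c - a * c') / 2 / (c * c')" if "c \<noteq> 0" "c' \<noteq> 0" for a a' c c' :: complex
      using that by (simp add: field_simps)
    from this[OF 1 2] have "- (W - cnj W) / 2 = ((u + cnj z) * (1 - u * z) - (1 + u * z) * (u - cnj z)) / 2 / ((1 - u * z) * (u - cnj z))"
      by (subst W', subst W) blast
    also have "(u + cnj z) * (1 - u * z) - (1 + u * z) * (u - cnj z) = 2 * (cnj z - u\<^sup>2 * z)"
      by (simp add: algebra_simps power2_eq_square)
    also have "2 * (cnj z - u\<^sup>2 * z) / 2 = cnj z - u\<^sup>2 * z"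
      by simp
    finally show ?thesis .
  qed
  finally show ?thesis .
qed

lemma one_plus_i_nz: "1 + \<i> * complex_of_real a \<noteq> 0"
  by (simp add: complex_eq_iff)

text \<open>\<open>cis (- b) / (1 + \<i> a)\<close> is half the difference of the conjugated endpoints of the geodesic
  and \<open>\<i> a\<close> times it is their midpoint.\<close>

lemma half_chord:
  fixes b :: real
  assumes z: "cmod z < 1"
  defines "e \<equiv> moeb z (cis (- b))"
  shows "cis (- b) / (1 + \<i> * fan_coord b z) = - (1 - z * cnj z) * e / (1 - z\<^sup>2 * e\<^sup>2)"
    and "1 - z\<^sup>2 * e\<^sup>2 \<noteq> 0"
proof -
  define u where "u = cis (- b)"
  define y where "y = cnj z"
  have 1: "1 - u * z \<noteq> 0" using one_minus_mult_nz[OF z, of u] by (simp add: u_def mult.commute)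
  have 2: "u - y \<noteq> 0"
    using z by (auto simp: u_def y_def) (metis complex_mod_cnj less_irrefl norm_cis)
  have 3: "u \<noteq> 0" by (simp add: u_def)
  have 4: "1 - z * y \<noteq> 0" using one_minus_mult_nz[OF z, of y] z by (simp add: y_def)
  have "1 + \<i> * fan_coord b z = u * (1 - 2 * u * z + y * z) / ((1 - u * z) * (u - y))"
  proof -
    have "1 + n / d = (d + n) / d" if "d \<noteq> 0" for n d :: complex
      using that by (simp add: field_simps)
    from this[of "(1 - u * z) * (u - y)"] 1 2
    have "1 + \<i> * fan_coord b z = ((1 - u * z) * (u - y) + (y - u\<^sup>2 * z)) / ((1 - u * z) * (u - y))"
      unfolding i_fan_coord[OF z u_def] y_def[symmetric] by simp
    also have "(1 - u * z) * (u - y) + (y - u\<^sup>2 * z) = u * (1 - 2 * u * z + y * z)"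
      by (simp add: algebra_simps power2_eq_square)
    finally show ?thesis .
  qed
  \<comment> \<open>If this factor vanished, so would \<open>1 + \<i> * a\<close>, whose real part
    is 1.\<close>
  moreover from this have 5: "1 - 2 * u * z + y * z \<noteq> 0"
    using one_plus_i_nz[of "fan_coord b z"] by auto
  ultimately have L: "u / (1 + \<i> * fan_coord b z) = (1 - u * z) * (u - y) / (1 - 2 * u * z + y * z)"
  proof -
    have "u / (u * s / c) = c / s" if "s \<noteq> 0" "c \<noteq> 0" for s c
      using that 3 by (simp add: field_simps)
    then show ?thesis
      using 1 2 5 \<open>1 + \<i> * fan_coord b z = _\<close> by simp
  qed
  have e: "e = (y - u) / (1 - u * z)" by (simp add: e_def moeb_def u_def y_def mult.commute)
  \<comment> \<open>A difference of squares: \<open>(1 - u * z)^2 - z^2 * (y - u)^2\<close> splits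
    into \<open>1 - z * y\<close> and the same factor \<open>1 - 2 * u * z + y * z\<close> that
    occurs in \<open>1 + \<i> * a\<close>.\<close>
  have D: "1 - z\<^sup>2 * e\<^sup>2 = (1 - z * y) * (1 - 2 * u * z + y * z) / (1 - u * z)\<^sup>2"
  proof -
    have "1 - z\<^sup>2 * (n / c)\<^sup>2 = (c\<^sup>2 - z\<^sup>2 * n\<^sup>2) / c\<^sup>2" if "c \<noteq> 0" for n c
      using that by (simp add: field_simps)
    from this[OF 1, of "y - u"] show ?thesis
      unfolding e by (simp add: algebra_simps power2_eq_square)
  qed
  then show "1 - z\<^sup>2 * e\<^sup>2 \<noteq> 0" using 1 4 5 by simp
  show "cis (- b) / (1 + \<i> * fan_coord b z) = - (1 - z * cnj z) * e / (1 - z\<^sup>2 * e\<^sup>2)"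
  proof -
    have "- p * (n / c) / (p * s / c\<^sup>2) = c * (- n) / s" if "p \<noteq> 0" "c \<noteq> 0" "s \<noteq> 0" for n c p s :: complex
      using that by (simp add: field_simps power2_eq_square)
    from this[OF 4 1 5, of "y - u"] show ?thesis
      unfolding D u_def[symmetric] y_def[symmetric] L unfolding e by simp
  qed
qed

text \<open>Squared moduli in \<open>half_chord\<close> give
  \<open>(1 - |z|^2)^2 / |1 - q|^2\<close>. As \<open>|q| = |z|^2\<close> on the circle, the real
  part on the right is \<open>(1 - |z|^4) / |1 - q|^2\<close>, and the quotient of the two
  numerators is \<open>bdf z\<close>. The weight is thus the real part of a function holomorphic in
  \<open>e\<close>.\<close>

lemma fan_coord_weight:
  fixes b :: real
  assumes z: "cmod z < 1"
  defines "q \<equiv> z\<^sup>2 * (moeb z (cis (- b)))\<^sup>2"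
  shows "1 / (1 + (fan_coord b z)\<^sup>2) = bdf z * Re ((1 + q) / (1 - q))"
proof -
  let ?e = "moeb z (cis (- b))"
  have e1: "cmod ?e = 1" using moeb_norm_eq[OF z] by simp
  have q: "cmod q = (cmod z)\<^sup>2" by (simp add: q_def norm_mult norm_power e1)
  have r: "1 - (cmod z)\<^sup>2 > 0" using z by (simp add: power_less_one_iff)
  have nz: "1 - q \<noteq> 0" using half_chord(2)[OF z] by (simp add: q_def)
  have "Re ((1 + q) / (1 - q)) = Re ((1 + q) * cnj (1 - q)) / (cmod (1 - q))\<^sup>2"
    by (subst complex_div_cnj) (simp only: of_real_power[symmetric] Re_divide_of_real)
  also have "Re ((1 + q) * cnj (1 - q)) = 1 - (cmod q)\<^sup>2"
    unfolding cmod_power2 by (simp add: power2_eq_square algebra_simps)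
  finally have R: "Re ((1 + q) / (1 - q)) = (1 - ((cmod z)\<^sup>2)\<^sup>2) / (cmod (1 - q))\<^sup>2"
    by (simp add: q)
  have "(cmod (cis (- b) / (1 + \<i> * fan_coord b z)))\<^sup>2 = 1 / (1 + (fan_coord b z)\<^sup>2)"
    by (simp add: norm_divide power_divide cmod_power2)
  moreover have "(cmod (- (1 - z * cnj z) * ?e / (1 - z\<^sup>2 * ?e\<^sup>2)))\<^sup>2 = (1 - (cmod z)\<^sup>2)\<^sup>2 / (cmod (1 - q))\<^sup>2"
  proof -
    have "cmod (1 - z * cnj z) = 1 - (cmod z)\<^sup>2"
    proof -
      have "1 - z * cnj z = complex_of_real (1 - (cmod z)\<^sup>2)"
        by (simp add: complex_norm_square del: of_real_power)
      then show ?thesis using r by (simp only: norm_of_real)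
    qed
    then show ?thesis
      by (simp only: norm_divide norm_mult norm_minus_cancel power_divide e1 q_def[symmetric]) simp
  qed
  ultimately have "1 / (1 + (fan_coord b z)\<^sup>2) = (1 - (cmod z)\<^sup>2)\<^sup>2 / (cmod (1 - q))\<^sup>2"
    using half_chord(1)[OF z, of b] by metis
  also have "\<dots> = bdf z * ((1 - ((cmod z)\<^sup>2)\<^sup>2) / (cmod (1 - q))\<^sup>2)"
  proof -
    have "(1 - x)\<^sup>2 = (1 - x) / (1 + x) * (1 - x\<^sup>2)" if "x \<ge> 0" for x :: real
      using that by (simp add: field_simps power2_eq_square)
    from this[of "(cmod z)\<^sup>2"] show ?thesis by (simp add: bdf_def)
  qed
  finally show ?thesis by (simp add: R)
qed

text \<open>The Poisson integral evaluates \<open>(1 + q) / (1 - q)\<close> at \<open>q = 0\<close>,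
  where it is 1, so only \<open>2 * pi * bdf z\<close> is left.\<close>

lemma fan_coord_weight_integral:
  assumes z: "cmod z < 1"
  shows "((\<lambda>b. poisson b z / (1 + (fan_coord b z)\<^sup>2)) has_integral 2 * pi * bdf z) {0..2*pi}"
proof -
  let ?f = "\<lambda>u. bdf z * ((1 + z\<^sup>2 * (moeb z u)\<^sup>2) / (1 - z\<^sup>2 * (moeb z u)\<^sup>2))"
  have "1 - z\<^sup>2 * (moeb z u)\<^sup>2 \<noteq> 0" if "cmod u \<le> 1" for u
    using z moeb_norm_le[OF z that]
    by (intro one_minus_mult_nz) (simp_all add: norm_power power_less_one_iff power_le_one)
  then have "?f holomorphic_on cball 0 1"
    using moeb_holomorphic[OF z] by (intro holomorphic_intros) (auto simp: dist_norm)
  from has_integral_Re[OF poisson_integral[OF this z]]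
  have "((\<lambda>b. Re (?f (cis (- b)) * poisson b z)) has_integral 2 * pi * bdf z) {0..2*pi}"
    by simp
  moreover have "Re (?f (cis (- b)) * poisson b z) = poisson b z / (1 + (fan_coord b z)\<^sup>2)" for b
  proof -
    have "Re (complex_of_real x * w * complex_of_real y) = y * (x * Re w)" for x y w
      by simp
    then have "Re (?f (cis (- b)) * poisson b z) = poisson b z * (1 / (1 + (fan_coord b z)\<^sup>2))"
      by (simp only: fan_coord_weight[OF z])
    then show ?thesis by simp
  qed
  ultimately show ?thesis by (simp only:)
qed

subsection \<open>Fourier modes of the kernel\<close>

text \<open>Newton's binomial series for the exponent \<open>- (N + 1)\<close>; the signs of the
  generalised binomial coefficient and of \<open>(- x) ^ n\<close> cancel.\<close>

lemma negative_binomial_sums: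
  fixes x :: complex
  assumes "cmod x < 1"
  shows "(\<lambda>p. of_nat (fact (p + N)) / of_nat (fact p) * x ^ p) sums (of_nat (fact N) / (1 - x) ^ Suc N)"
proof -
  have "(\<lambda>n. ((- of_nat (Suc N)) gchoose n) * (- x) ^ n) sums (1 + (- x)) powr (- of_nat (Suc N))"
    by (rule gen_binomial_complex) (use assms in simp)
  also have "(1 + (- x)) powr (- of_nat (Suc N)) = 1 / (1 - x) ^ Suc N"
  proof -
    have "(1 - x) powr of_nat (Suc N) = (1 - x) ^ Suc N"
      by (rule powr_nat') simp
    then show ?thesis by (simp only: powr_minus diff_conv_add_uminus[symmetric] inverse_eq_divide)
  qed
  finally have "(\<lambda>n. of_nat (fact N) * (((- of_nat (Suc N)) gchoose n) * (- x) ^ n)) sums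
      (of_nat (fact N) * (1 / (1 - x) ^ Suc N))"
    by (rule sums_mult)
  moreover have "of_nat (fact N) * (((- of_nat (Suc N)) gchoose n) * (- x) ^ n) =
      of_nat (fact (n + N)) / of_nat (fact n) * x ^ n" for n
  proof -
    have "(- of_nat (Suc N) :: complex) gchoose n = (- 1) ^ n * (of_nat (n + N) gchoose n)"
      by (subst gbinomial_minus) (simp add: algebra_simps)
    also have "of_nat (n + N) gchoose n = (of_nat ((n + N) choose n) :: complex)"
      by (simp add: binomial_gbinomial)
    also have "\<dots> = fact (n + N) / (fact n * fact N)"
      by (simp add: binomial_fact)
    finally have "(- of_nat (Suc N) :: complex) gchoose n = (- 1) ^ n * (fact (n + N) / (fact n * fact N))" .
    moreover have "(- x) ^ n = (- 1) ^ n * x ^ n" by (rule power_minus)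
    moreover have "(- 1) ^ n * (- 1) ^ n = (1 :: complex)"
      by (simp flip: power_add power_mult_distrib)
    moreover have "F * ((s * (A / (B * F))) * (s * y)) = A / B * y" if "s * s = 1" "F \<noteq> 0" for F s A B y :: complex
    proof -
      have "F * ((s * (A / (B * F))) * (s * y)) = (s * s) * (F * (A / (B * F))) * y" by (simp only: ac_simps)
      then show ?thesis using that by simp
    qed
    ultimately show ?thesis
      by (simp only: of_nat_fact fact_nonzero not_False_eq_True)
  qed
  ultimately show ?thesis by simp
qed

lemma one_plus_sq_pos: "1 + (a :: real)\<^sup>2 > 0"
  by (simp add: add_pos_nonneg)

text \<open>In polar form this is \<open>exp (- \<i> * (b + arctan a)) / sqrt (1 + a^2)\<close>, the
  combination occurring in \<open>Gker\<close>; the form chosen here avoids \<open>arctan\<close>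
  and the root.\<close>

definition chord :: "real \<Rightarrow> real \<Rightarrow> complex" where
  "chord b a = cis (- b) / (1 + \<i> * complex_of_real a)"

text \<open>The prefactor of \<open>Gker\<close> contains \<open>1 / (4 * k - 2)!\<close> and its
  series sums to a multiple of \<open>(4 * k - 1)!\<close>; the quotient is
  \<open>4 * k - 1\<close>.\<close>

definition Gconst :: "nat \<Rightarrow> real" where
  "Gconst k = (4 * real k - 1) * 4 ^ k / (8 * pi\<^sup>2)"

lemma norm_chord_sq: "(cmod (chord b a))\<^sup>2 = 1 / (1 + a\<^sup>2)"
  by (simp add: chord_def norm_divide power_divide cmod_power2)

lemma norm_chord_le_1: "cmod (chord b a) \<le> 1"
proof -
  have "(cmod (chord b a))\<^sup>2 \<le> 1"
    using one_plus_sq_pos[of a] by (simp add: norm_chord_sq divide_le_eq)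
  then show ?thesis by (simp add: power_le_one_iff abs_square_le_1)
qed

lemma exp_arctan:
  "exp (- \<i> * complex_of_real (b + arctan a)) = complex_of_real (sqrt (1 + a\<^sup>2)) * chord b a"
proof -
  let ?s = "sqrt (1 + a\<^sup>2)"
  have s: "complex_of_real ?s * complex_of_real ?s = 1 + (complex_of_real a)\<^sup>2"
  proof -
    have "complex_of_real (?s * ?s) = complex_of_real (1 + a\<^sup>2)"
      by (rule arg_cong[where f=complex_of_real]) simp
    then show ?thesis by (simp only: of_real_mult of_real_add of_real_power of_real_1)
  qed
  have s0: "?s \<noteq> 0" using one_plus_sq_pos[of a] by simp
  have "exp (- \<i> * complex_of_real (b + arctan a)) = cis (- b + - arctan a)"
    by (simp add: cis_conv_exp algebra_simps)
  also have "\<dots> = cis (- b) * cis (- arctan a)"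
    by (simp only: cis_mult)
  also have "cis (- arctan a) = (1 - \<i> * a) / ?s"
    by (simp add: complex_eq_iff cos_arctan sin_arctan)
  also have "(1 - \<i> * a) / ?s = ?s / (1 + \<i> * a)"
  proof -
    have "(1 - \<i> * a) * (1 + \<i> * a) = complex_of_real ?s * complex_of_real ?s"
      unfolding s by (simp add: algebra_simps power2_eq_square)
    then show ?thesis using s0 one_plus_i_nz[of a] by (simp add: frac_eq_eq)
  qed
  finally show ?thesis by (simp add: chord_def)
qed

lemma norm_a_chord_less_1: "cmod (\<i> * complex_of_real a * chord b a) < 1"
proof -
  have "(cmod (\<i> * complex_of_real a * chord b a))\<^sup>2 = a\<^sup>2 / (1 + a\<^sup>2)"
    by (simp add: norm_mult power_mult_distrib norm_chord_sq)
  also have "\<dots> < 1" by (simp add: add_pos_nonneg divide_less_eq)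
  finally show ?thesis by (simp add: power_less_one_iff abs_square_less_1)
qed

text \<open>The series is \<open>negative_binomial_sums\<close> with \<open>N = 4 * k - 1\<close>,
  so the denominator has exponent \<open>4 * k\<close>, twice the exponent of \<open>chord\<close>.
  The powers of \<open>1 + a^2\<close> cancel against the modulus of the exponential's
  \<open>chord\<close> form.\<close>

lemma Gker_closed_form:
  assumes k: "k \<ge> 1" and w: "cmod w < 1"
  shows "Gker k b a w = Gconst k * (chord b a / (1 - \<i> * a * chord b a * w)\<^sup>2) ^ (2 * k)"
proof -
  let ?s = "sqrt (1 + a\<^sup>2)" and ?x = "\<i> * a * chord b a * w"
  have s0: "?s \<noteq> 0" using one_plus_sq_pos[of a] by simp
  have x: "\<i> * complex_of_real a * w * exp (- \<i> * complex_of_real (b + arctan a)) / ?s = ?x"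
    unfolding exp_arctan using s0 by simp
  have x1: "cmod ?x < 1"
  proof -
    have "cmod ?x \<le> cmod (\<i> * a * chord b a) * 1"
      unfolding norm_mult[of _ w] by (intro mult_left_mono) (use w in auto)
    then show ?thesis using norm_a_chord_less_1[of a b] by linarith
  qed
  have "exp (- 2 * \<i> * of_nat k * complex_of_real (b + arctan a)) = exp (- \<i> * complex_of_real (b + arctan a)) ^ (2 * k)"
    by (simp add: exp_of_nat_mult[symmetric] algebra_simps)
  also have "\<dots> = complex_of_real ((1 + a\<^sup>2) ^ k) * chord b a ^ (2 * k)"
  proof -
    have "?s ^ (2 * k) = (1 + a\<^sup>2) ^ k"
      using one_plus_sq_pos[of a] by (simp add: power_mult)
    then show ?thesis
      unfolding exp_arctan power_mult_distrib by (simp only: of_real_power[symmetric])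
  qed
  finally have e: "exp (- 2 * \<i> * of_nat k * complex_of_real (b + arctan a)) =
      complex_of_real ((1 + a\<^sup>2) ^ k) * chord b a ^ (2 * k)" .
  have p: "p + 4 * k - 1 = p + (4 * k - 1)" for p using k by simp
  have "(\<Sum>p. of_nat (fact (p + 4 * k - 1)) / of_nat (fact p) * ?x ^ p) =
      of_nat (fact (4 * k - 1)) / (1 - ?x) ^ Suc (4 * k - 1)"
    unfolding p by (rule sums_unique[OF negative_binomial_sums[OF x1], symmetric])
  also have "Suc (4 * k - 1) = 2 * (2 * k)" using k by simp
  also have "(1 - ?x) ^ (2 * (2 * k)) = ((1 - ?x)\<^sup>2) ^ (2 * k)" by (rule power_mult)
  also have "fact (4 * k - 1) = (4 * k - 1) * fact (4 * k - 2)"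
    using k by (subst fact_reduce) (auto simp: numeral_2_eq_2)
  finally have S: "(\<Sum>p. of_nat (fact (p + 4 * k - 1)) / of_nat (fact p) * ?x ^ p) =
      of_nat ((4 * k - 1) * fact (4 * k - 2)) / ((1 - ?x)\<^sup>2) ^ (2 * k)" .
  have A: "complex_of_real ((1 + a\<^sup>2) ^ k) \<noteq> 0"
    unfolding of_real_eq_0_iff using one_plus_sq_pos[of a] by simp
  have F: "(of_nat (fact (4 * k - 2)) :: complex) \<noteq> 0"
    by simp
  have N: "(of_nat (4 * k - 1) :: complex) = complex_of_real (4 * real k - 1)"
    using k by (simp add: of_nat_diff)
  have gen: "P * (A * c) / (8 * q * F * A) * (n * F / d) = n * P / (8 * q) * (c / d)"
    if "A \<noteq> 0" "F \<noteq> 0" for A F P c q n d :: complex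
    using that by simp
  show ?thesis
    unfolding Gker_def x e S of_nat_mult N gen[OF A F]
    by (simp add: Gconst_def power_divide)
qed

lemma measurable_Gker:
  assumes "k \<ge> 1" "cmod w < 1"
  shows "(\<lambda>x. Gker k (fst x) (snd x) w) \<in> borel_measurable borel"
  unfolding Gker_closed_form[OF assms] chord_def by measurable

text \<open>Of \<open>|chord| ^ (2 * k)\<close> only \<open>|chord|^2 = 1 / (1 + a^2)\<close> is
  kept, so that one weight serves for every \<open>k\<close>; the denominator stays away from 0 by
  \<open>1 - |w|\<close>.\<close>

lemma norm_Gker_le:
  assumes k: "k \<ge> 1" and w: "cmod w < 1"
  shows "cmod (Gker k b a w) \<le> \<bar>Gconst k\<bar> / (1 - cmod w) ^ (4 * k) * (1 / (1 + a\<^sup>2))"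
proof -
  let ?d = "1 - \<i> * a * chord b a * w"
  have d: "cmod ?d \<ge> 1 - cmod w"
  proof -
    have "cmod (\<i> * a * chord b a * w) \<le> 1 * cmod w"
      unfolding norm_mult[of _ w] using norm_a_chord_less_1[of a b] by (intro mult_right_mono) auto
    then show ?thesis using norm_triangle_ineq2[of 1 "\<i> * a * chord b a * w"] by simp
  qed
  have "cmod (chord b a) ^ (2 * k) \<le> cmod (chord b a) ^ 2"
    using k norm_chord_le_1 by (intro power_decreasing) auto
  moreover have "(1 - cmod w) ^ (4 * k) \<le> cmod ?d ^ (4 * k)"
    using d w by (intro power_mono) auto
  moreover have "(1 - cmod w) ^ (4 * k) > 0" using w by simp
  ultimately have "cmod (chord b a) ^ (2 * k) / cmod ?d ^ (4 * k) \<le> (1 / (1 + a\<^sup>2)) / (1 - cmod w) ^ (4 * k)"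
    unfolding norm_chord_sq by (intro frac_le) auto
  then have "\<bar>Gconst k\<bar> * (cmod (chord b a) ^ (2 * k) / cmod ?d ^ (4 * k)) \<le>
      \<bar>Gconst k\<bar> * ((1 / (1 + a\<^sup>2)) / (1 - cmod w) ^ (4 * k))"
    by (intro mult_left_mono) auto
  moreover have "cmod (Gker k b a w) = \<bar>Gconst k\<bar> * (cmod (chord b a) ^ (2 * k) / cmod ?d ^ (4 * k))"
    unfolding Gker_closed_form[OF k w]
    by (simp add: norm_mult norm_power norm_divide power_divide flip: power_mult)
  ultimately show ?thesis by (simp add: mult.commute)
qed

text \<open>The cofactor of \<open>e\<close> in the base of the kernel's \<open>2 * k\<close>-th
  power. It is written for an arbitrary complex \<open>e\<close> so that it can be continued
  holomorphically from the fibre circle into the disk.\<close>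

definition ker_mode :: "complex \<Rightarrow> complex \<Rightarrow> complex \<Rightarrow> complex" where
  "ker_mode z w e = - (1 - z * cnj z) * (1 - z\<^sup>2 * e\<^sup>2) / (1 - cnj z * w - z * (z - w) * e\<^sup>2)\<^sup>2"

text \<open>The pseudohyperbolic distance of \<open>z\<close> and \<open>w\<close> is below 1, that
  is \<open>|z - w| < |1 - cnj z * w|\<close>; the subtracted term has modulus at most
  \<open>|z - w|\<close>.\<close>

lemma ker_mode_denominator_nz:
  assumes z: "cmod z < 1" and w: "cmod w < 1" and e: "cmod e \<le> 1"
  shows "1 - cnj z * w - z * (z - w) * e\<^sup>2 \<noteq> 0"
proof
  assume "1 - cnj z * w - z * (z - w) * e\<^sup>2 = 0"
  then have "cmod (1 - cnj z * w) = cmod z * cmod (z - w) * (cmod e)\<^sup>2"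
    by (simp add: norm_mult norm_power)
  also have "\<dots> \<le> 1 * cmod (z - w) * 1"
    using z e by (intro mult_mono) (auto simp: power_le_one)
  finally have "(cmod (1 - cnj z * w))\<^sup>2 \<le> (cmod (z - w))\<^sup>2"
    by (intro power_mono) auto
  moreover have "(cmod (1 - cnj z * w))\<^sup>2 - (cmod (z - w))\<^sup>2 = (1 - (cmod z)\<^sup>2) * (1 - (cmod w)\<^sup>2)"
    unfolding cmod_power2 by (simp add: power2_eq_square algebra_simps)
  moreover have "(1 - (cmod z)\<^sup>2) * (1 - (cmod w)\<^sup>2) > 0"
    using z w by (simp add: power_less_one_iff)
  ultimately show False by linarith
qed

text \<open>On the circle of directions at \<open>z\<close> the kernel is \<open>e ^ (2 * k)\<close> times a power series in \<open>e\<close>,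
  where \<open>e\<close> is the conjugate of the direction.\<close>

lemma Gker_fan_coord:
  assumes k: "k \<ge> 1" and w: "cmod w < 1" and z: "cmod z < 1"
  defines "e \<equiv> \<lambda>b. moeb z (cis (- b))"
  shows "Gker k b (fan_coord b z) w = Gconst k * (e b * ker_mode z w (e b)) ^ (2 * k)"
proof -
  define n where "n = e b"
  define u where "u = cis (- b)"
  define y where "y = cnj z"
  define m where "m = chord b (fan_coord b z)"
  have n1: "cmod n \<le> 1" using moeb_norm_eq[OF z] by (simp add: n_def e_def)
  have u1: "1 - z * u \<noteq> 0" using one_minus_mult_nz[OF z, of u] by (simp add: u_def)
  have 1: "1 - z * n \<noteq> 0" using one_minus_mult_nz[OF z n1] .
  have 2: "1 - z\<^sup>2 * n\<^sup>2 \<noteq> 0" using half_chord(2)[OF z] by (simp add: n_def e_def)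
  have 3: "1 - y * w - z * (z - w) * n\<^sup>2 \<noteq> 0"
    using ker_mode_denominator_nz[OF z w n1] by (simp add: y_def)
  have m: "m = - (1 - z * y) * n / (1 - z\<^sup>2 * n\<^sup>2)"
    unfolding m_def chord_def n_def e_def y_def by (rule half_chord(1)[OF z])
  have "n * (1 - z * u) = y - u" using u1 by (simp add: n_def e_def moeb_def u_def y_def)
  then have u: "u * (1 - z * n) = y - n" by (simp add: algebra_simps)
  have "m * (1 + \<i> * fan_coord b z) = u"
    using one_plus_i_nz[of "fan_coord b z"] by (simp add: m_def chord_def u_def)
  \<comment> \<open>Midpoint equals conjugated initial endpoint minus half the difference of the
    conjugated endpoints.\<close>
  then have "\<i> * fan_coord b z * m = u - m" by (simp add: algebra_simps)
  also have "\<dots> = (y - z * n\<^sup>2) / (1 - z\<^sup>2 * n\<^sup>2)"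
  proof -
    have "u * (1 - z\<^sup>2 * n\<^sup>2) = (y - n) * (1 + z * n)"
      by (simp flip: u add: algebra_simps power2_eq_square)
    moreover have "m * (1 - z\<^sup>2 * n\<^sup>2) = - (1 - z * y) * n" using m 2 by simp
    ultimately have "(u - m) * (1 - z\<^sup>2 * n\<^sup>2) = y - z * n\<^sup>2"
      by (simp only: left_diff_distrib) (simp add: algebra_simps power2_eq_square)
    then show ?thesis using 2 by (simp add: field_simps)
  qed
  finally have nu: "\<i> * fan_coord b z * m = (y - z * n\<^sup>2) / (1 - z\<^sup>2 * n\<^sup>2)" .
  have "1 - \<i> * fan_coord b z * m * w = (1 - y * w - z * (z - w) * n\<^sup>2) / (1 - z\<^sup>2 * n\<^sup>2)"
  proof -
    have "1 - p / q * w = (q - p * w) / q" if "q \<noteq> 0" for p q :: complex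
      using that by (simp add: field_simps)
    from this[OF 2, of "y - z * n\<^sup>2"]
    have "1 - \<i> * fan_coord b z * m * w = (1 - z\<^sup>2 * n\<^sup>2 - (y - z * n\<^sup>2) * w) / (1 - z\<^sup>2 * n\<^sup>2)"
      unfolding nu .
    also have "1 - z\<^sup>2 * n\<^sup>2 - (y - z * n\<^sup>2) * w = 1 - y * w - z * (z - w) * n\<^sup>2"
      by (simp add: algebra_simps power2_eq_square)
    finally show ?thesis .
  qed
  \<comment> \<open>\<open>m\<close> contains \<open>1 - z^2 * n^2\<close> once in the denominator
    and the square contains it twice; the surplus copy becomes the factor
    \<open>1 - z^2 * e^2\<close> of \<open>ker_mode\<close>.\<close>
  then have "m / (1 - \<i> * fan_coord b z * m * w)\<^sup>2 = n * ker_mode z w n"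
  proof -
    have "(- p * n / q) / (d / q)\<^sup>2 = n * (- p * q / d\<^sup>2)" if "q \<noteq> 0" "d \<noteq> 0" for p q d :: complex
      using that by (simp add: field_simps power2_eq_square)
    from this[OF 2 3] show ?thesis
      unfolding \<open>1 - \<i> * fan_coord b z * m * w = _\<close> ker_mode_def y_def[symmetric]
      unfolding m .
  qed
  then show ?thesis
    unfolding Gker_closed_form[OF k w] m_def[symmetric] n_def by simp
qed

lemma ker_mode_integral:
  assumes z: "cmod z < 1" and w: "cmod w < 1"
  defines "e \<equiv> \<lambda>b. moeb z (cis (- b))"
  shows "((\<lambda>b. e b ^ m * ker_mode z w (e b) ^ l * poisson b z) has_integral
     2 * pi * (0 ^ m * ker_mode z w 0 ^ l)) {0..2*pi}"
proof -
  let ?f = "\<lambda>u. moeb z u ^ m * ker_mode z w (moeb z u) ^ l"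
  have "1 - cnj z * w - z * (z - w) * (moeb z u)\<^sup>2 \<noteq> 0" if "cmod u \<le> 1" for u
    using ker_mode_denominator_nz[OF z w moeb_norm_le[OF z that]] .
  then have "?f holomorphic_on cball 0 1"
    using moeb_holomorphic[OF z] unfolding ker_mode_def
    by (intro holomorphic_intros) (auto simp: dist_norm)
  from poisson_integral[OF this z] show ?thesis by (simp add: e_def)
qed

text \<open>As the direction is \<open>1 / e\<close>, the three integrands carry \<open>e\<close> to
  the powers \<open>2 * k - 2 * j\<close>, \<open>0\<close> and \<open>2 * k + 2 * j\<close> in
  front of \<open>ker_mode ^ (2 * k)\<close>. Only the exponent 0 leaves a constant term, namely
  \<open>ker_mode\<close> at \<open>e = 0\<close> to the power \<open>2 * k\<close>.\<close>

lemma Gker_mode_integrals: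
  assumes k: "k \<ge> 1" and w: "cmod w < 1" and z: "cmod z < 1"
  shows "j < k \<Longrightarrow> ((\<lambda>b. direction b z ^ (2 * j) * Gker k b (fan_coord b z) w * poisson b z) has_integral 0) {0..2*pi}"
    and "((\<lambda>b. direction b z ^ (2 * k) * Gker k b (fan_coord b z) w * poisson b z) has_integral
      2 * pi * Gconst k * ((1 - z * cnj z) ^ (2 * k) / (1 - cnj z * w) ^ (4 * k))) {0..2*pi}"
    and "((\<lambda>b. cnj (direction b z) ^ (2 * j) * Gker k b (fan_coord b z) w * poisson b z) has_integral 0) {0..2*pi}"
proof -
  let ?e = "\<lambda>b. moeb z (cis (- b))"
  have direction: "direction b z ^ (2 * j) * Gker k b (fan_coord b z) w = Gconst k * (?e b ^ (2 * k - 2 * j) * ker_mode z w (?e b) ^ (2 * k))"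
    if "j \<le> k" for j b
  proof -
    have "direction b z ^ (2 * j) * ?e b ^ (2 * k) = (direction b z * ?e b) ^ (2 * j) * ?e b ^ (2 * k - 2 * j)"
      using that by (simp add: power_mult_distrib flip: power_add)
    then have "direction b z ^ (2 * j) * ?e b ^ (2 * k) = ?e b ^ (2 * k - 2 * j)"
      by (simp add: direction_moeb[OF z])
    then show ?thesis
    proof -
      have "d * (c * (x * r)) = c * (d * x * r)" for d c x r :: complex by simp
      then show ?thesis
        unfolding Gker_fan_coord[OF k w z] power_mult_distrib by (simp only: \<open>direction b z ^ (2 * j) * ?e b ^ (2 * k) = ?e b ^ (2 * k - 2 * j)\<close>)
    qed
  qed
  have int: "((\<lambda>b. Gconst k * (?e b ^ m * ker_mode z w (?e b) ^ (2 * k)) * poisson b z) has_integral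
      Gconst k * (2 * pi * (0 ^ m * ker_mode z w 0 ^ (2 * k)))) {0..2*pi}" for m
    using has_integral_mult_right[OF ker_mode_integral[OF z w, of m "2 * k"], of "Gconst k"]
    by (simp add: mult.assoc)
  show "((\<lambda>b. direction b z ^ (2 * j) * Gker k b (fan_coord b z) w * poisson b z) has_integral 0) {0..2*pi}" if "j < k"
    using int[of "2 * k - 2 * j"] that by (simp add: direction power_0_left)
  have "ker_mode z w 0 ^ (2 * k) = (1 - z * cnj z) ^ (2 * k) / (1 - cnj z * w) ^ (4 * k)"
  proof -
    have "(- x) ^ (2 * k) = x ^ (2 * k)" for x :: complex by (simp add: power_mult)
    from this[of "1 - z * cnj z"] show ?thesis
      by (simp add: ker_mode_def power_divide flip: power_mult)
  qed
  then show "((\<lambda>b. direction b z ^ (2 * k) * Gker k b (fan_coord b z) w * poisson b z) has_integral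
      2 * pi * Gconst k * ((1 - z * cnj z) ^ (2 * k) / (1 - cnj z * w) ^ (4 * k))) {0..2*pi}"
    using int[of 0] unfolding direction[OF order_refl] by (simp add: mult_ac)
  have "cnj (direction b z) ^ (2 * j) * Gker k b (fan_coord b z) w = Gconst k * (?e b ^ (2 * k + 2 * j) * ker_mode z w (?e b) ^ (2 * k))" for b
    unfolding Gker_fan_coord[OF k w z] cnj_direction by (simp add: power_mult_distrib power_add mult_ac)
  then show "((\<lambda>b. cnj (direction b z) ^ (2 * j) * Gker k b (fan_coord b z) w * poisson b z) has_integral 0) {0..2*pi}"
    using int[of "2 * k + 2 * j"] k by (simp add: power_0_left)
qed

subsection \<open>Santalo's formula\<close>

text \<open>Against \<open>1 / (1 + a\<^sup>2)\<close>, which dominates the kernel, the average over all geodesics through \<open>z\<close> is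
  exactly \<open>bdf z\<close> (see \<open>fan_coord_weight_integral\<close>), so this weight is what absolute convergence requires.\<close>

definition admissible :: "(complex \<Rightarrow> complex) \<Rightarrow> bool" where
  "admissible H \<longleftrightarrow> H \<in> borel_measurable borel \<and>
     set_integrable lborel (ball 0 1) (\<lambda>z. cmod (H z) * bdf z / (cfac z)\<^sup>2)"

section \<open>Absolute convergence from the weighted spaces\<close>

lemma bdf_pos: "cmod z < 1 \<Longrightarrow> bdf z > 0"
  by (simp add: bdf_def power_less_one_iff add_pos_nonneg)

lemma bdf_le:
  assumes "cmod z < 1"
  shows "bdf z \<le> 2 * cfac z" "bdf z \<le> 1"
proof -
  have x: "(cmod z)\<^sup>2 \<le> 1" "0 \<le> (cmod z)\<^sup>2" using assms by (simp_all add: power_le_one)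
  have "(1 - x) / (1 + x) \<le> 1 - x" if "x \<le> 1" "0 \<le> x" for x :: real
  proof -
    have "1 - x \<le> (1 - x) * (1 + x)" using that by (simp add: algebra_simps mult_left_le)
    then show ?thesis using that by (simp add: divide_le_eq)
  qed
  note le = this[OF x]
  show "bdf z \<le> 2 * cfac z"
  proof -
    have "2 * cfac z = 1 - (cmod z)\<^sup>2" by (simp add: cfac_def)
    then show ?thesis using le by (simp only: bdf_def)
  qed
  show "bdf z \<le> 1" using x by (simp add: bdf_def divide_le_eq add_pos_nonneg)
qed

text \<open>Split \<open>|H| * bdf\<close> as
  \<open>(bdf powr (- d) * |H|) * (bdf powr d * bdf)\<close> and bound the product by the sum of
  squares. The first square is the given integrand; since \<open>d > 0\<close> and
  \<open>bdf \<le> 2 * cfac\<close>, the second is at most \<open>4 * cfac^2\<close>, which becomes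
  the constant 4 on a disk of finite area.\<close>

lemma admissibleI:
  assumes H [measurable]: "H \<in> borel_measurable borel"
    and d: "d > 0"
    and g: "set_integrable lborel (ball 0 1) g"
    and le: "\<And>z. cmod z < 1 \<Longrightarrow> bdf z powr (- 2 * d) * (cmod (H z))\<^sup>2 / (cfac z)\<^sup>2 \<le> g z"
  shows "admissible H"
  unfolding admissible_def
proof (intro conjI)
  show "set_integrable lborel (ball 0 1) (\<lambda>z. cmod (H z) * bdf z / (cfac z)\<^sup>2)"
  proof (rule set_integrable_bound)
    have "set_integrable lborel (ball (0::complex) 1) (\<lambda>z. 4 :: real)"
      unfolding set_integrable_def
      by (intro integrable_scaleR_left integrable_real_indicator) (use emeasure_lborel_ball_finite[of "0::complex" 1] in simp_all)
    then show "set_integrable lborel (ball 0 1) (\<lambda>z. g z + 4)"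
      using g by (intro set_integral_add)
    show "set_borel_measurable lborel (ball 0 1) (\<lambda>z. cmod (H z) * bdf z / (cfac z)\<^sup>2)"
      unfolding set_borel_measurable_def by measurable
    show "AE z in lborel. z \<in> ball 0 1 \<longrightarrow>
        norm (cmod (H z) * bdf z / (cfac z)\<^sup>2) \<le> norm (g z + 4)"
    proof (intro AE_I2 impI)
      fix z :: complex assume "z \<in> ball 0 1"
      then have z: "cmod z < 1" by simp
      let ?x = "bdf z powr (- d) * cmod (H z)" and ?y = "bdf z powr d * bdf z"
      have b: "bdf z > 0" and c: "cfac z > 0" using bdf_pos[OF z] z by (auto simp: cfac_pos_iff)
      have "cmod (H z) * bdf z = ?x * ?y"
        using b by (simp add: powr_minus field_simps)
      also have "\<dots> \<le> ?x\<^sup>2 + ?y\<^sup>2"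
      proof -
        have "x * y \<le> x\<^sup>2 + y\<^sup>2" if "0 \<le> x" "0 \<le> y" for x y :: real
          using sum_squares_bound[of x y] mult_nonneg_nonneg[OF that] by linarith
        then show ?thesis using b by simp
      qed
      also have "?x\<^sup>2 = bdf z powr (- 2 * d) * (cmod (H z))\<^sup>2"
        using b by (simp add: power_mult_distrib powr_power)
      also have "?y\<^sup>2 \<le> 1 * (2 * cfac z)\<^sup>2"
        unfolding power_mult_distrib[of "bdf z powr d"]
      proof (intro mult_mono power_mono bdf_le(1)[OF z])
        have "bdf z powr d \<le> 1" using b bdf_le(2)[OF z] d by (simp add: powr_le1)
        then show "(bdf z powr d)\<^sup>2 \<le> 1" by (simp add: power_le_one)
      qed (use b in auto)
      finally have "cmod (H z) * bdf z / (cfac z)\<^sup>2 \<le>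
          (bdf z powr (- 2 * d) * (cmod (H z))\<^sup>2 + 1 * (2 * cfac z)\<^sup>2) / (cfac z)\<^sup>2"
        by (intro divide_right_mono) auto
      also have "\<dots> = bdf z powr (- 2 * d) * (cmod (H z))\<^sup>2 / (cfac z)\<^sup>2 + 4"
        using c by (simp add: add_divide_distrib power_mult_distrib)
      also have "\<dots> \<le> g z + 4" using le[OF z] by simp
      finally show "norm (cmod (H z) * bdf z / (cfac z)\<^sup>2) \<le> norm (g z + 4)"
        using b by (simp add: abs_mult)
    qed
  qed
qed simp

lemma admissible_scalar:
  assumes "d > 0" "wL2_scalar d u"
  shows "admissible u"
  using assms by (intro admissibleI[of u d]) (auto simp: wL2_scalar_def)

lemma admissible_tt:
  assumes d: "d > 0" and u: "wL2_tt d m hp hm"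
  shows "admissible (\<lambda>z. hp z * cfac z ^ m)" "admissible (\<lambda>z. hm z * cfac z ^ m)"
proof -
  have [measurable]: "hp \<in> borel_measurable borel" "hm \<in> borel_measurable borel"
    using u by (simp_all add: wL2_tt_def)
  let ?g = "\<lambda>z. bdf z powr (-2*d) * (cfac z)^(2*m) * ((cmod (hp z))^2 + (cmod (hm z))^2) / (cfac z)^2"
  have g: "set_integrable lborel (ball 0 1) ?g"
    using u by (simp add: wL2_tt_def)
  have le: "bdf z powr (- 2 * d) * (cmod (h z * cfac z ^ m))\<^sup>2 / (cfac z)\<^sup>2 \<le> ?g z"
    if "(cmod (h z))\<^sup>2 \<le> (cmod (hp z))^2 + (cmod (hm z))^2" for z and h :: "complex \<Rightarrow> complex"
  proof -
    have "(cmod (h z * cfac z ^ m))\<^sup>2 = (cfac z)^(2*m) * (cmod (h z))\<^sup>2"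
    proof -
      have "(\<bar>cfac z\<bar> ^ m)\<^sup>2 = \<bar>cfac z\<bar> ^ (2 * m)"
        by (simp only: power_mult[symmetric] mult.commute)
      then show ?thesis
        by (simp add: norm_mult norm_power power_mult_distrib power_even_abs)
    qed
    moreover have "0 \<le> (cfac z)^(2*m)" by (simp add: power_mult)
    ultimately show ?thesis
      using that by (simp add: divide_right_mono mult_left_mono mult.assoc)
  qed
  show "admissible (\<lambda>z. hp z * cfac z ^ m)" "admissible (\<lambda>z. hm z * cfac z ^ m)"
    by (rule admissibleI[OF _ d g le[of hp]]; simp) (rule admissibleI[OF _ d g le[of hm]]; simp)
qed

definition flow_density :: "real \<times> complex \<Rightarrow> real" where
  "flow_density p = indicator (ball 0 1) (snd p) * (poisson (fst p) (snd p) / (cfac (snd p))\<^sup>2)"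

text \<open>A unit tangent vector is encoded by its foot point together with the initial endpoint of
  its geodesic; the direction is recovered as \<open>direction b z\<close>. In this encoding the
  flow leaves \<open>b\<close> untouched.\<close>

definition flow :: "(real \<times> real) \<times> real \<Rightarrow> real \<times> complex" where
  "flow x = (fst (fst x), geod (fst (fst x)) (snd (fst x)) (snd x))"

lemma measurable_flow_density [measurable]: "flow_density \<in> borel_measurable borel"
  unfolding flow_density_def by measurable

lemma measurable_flow [measurable]: "flow \<in> borel_measurable borel"
  unfolding flow_def by measurable

lemma flow_density_nonneg: "flow_density p \<ge> 0"
  using poisson_pos[of "snd p" "fst p"] by (auto simp: flow_density_def indicator_def less_imp_le)

lemma nn_integral_lborel_fst:
  fixes f :: "'a::euclidean_space \<times> 'b::euclidean_space \<Rightarrow> ennreal"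
  assumes "f \<in> borel_measurable borel"
  shows "(\<integral>\<^sup>+x. f x \<partial>lborel) = (\<integral>\<^sup>+x. \<integral>\<^sup>+y. f (x, y) \<partial>lborel \<partial>lborel)"
  using lborel.nn_integral_fst[of f lborel] assms by (simp add: lborel_prod borel_prod)

lemma nn_integral_lborel_snd:
  fixes f :: "'a::euclidean_space \<times> 'b::euclidean_space \<Rightarrow> ennreal"
  assumes "f \<in> borel_measurable borel"
  shows "(\<integral>\<^sup>+x. f x \<partial>lborel) = (\<integral>\<^sup>+y. \<integral>\<^sup>+x. f (x, y) \<partial>lborel \<partial>lborel)"
  using lborel_pair.nn_integral_snd[of f] assms by (simp add: lborel_prod borel_prod)

text \<open>Since \<open>b\<close> is preserved, Tonelli reduces the claim to
  \<open>nn_integral_geod\<close> for each fixed \<open>b\<close>. Here \<open>b\<close> runs over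
  the whole line; the restriction to one period enters later through the integrand.\<close>

lemma santalo_formula: "distr lborel borel flow = density lborel flow_density"
  (is "?M = ?N")
proof (rule measure_eqI)
  fix A assume "A \<in> sets ?M"
  then have A [measurable]: "A \<in> sets borel" by simp
  have "emeasure ?M A = (\<integral>\<^sup>+z. indicator A z \<partial>?M)" by simp
  also have "\<dots> = (\<integral>\<^sup>+x. indicator A (flow x) \<partial>lborel)"
    by (rule nn_integral_distr) auto
  also have "\<dots> = (\<integral>\<^sup>+p. \<integral>\<^sup>+t. indicator A (flow (p, t)) \<partial>lborel \<partial>lborel)"
    by (rule nn_integral_lborel_fst) measurable
  also have "\<dots> = (\<integral>\<^sup>+b. \<integral>\<^sup>+a. \<integral>\<^sup>+t. indicator A (flow ((b, a), t)) \<partial>lborel \<partial>lborel \<partial>lborel)"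
  proof (rule nn_integral_lborel_fst)
    have "(\<lambda>(p, t). indicator A (flow (p, t)) :: ennreal) \<in> borel_measurable (borel \<Otimes>\<^sub>M lborel)"
      by measurable
    then show "(\<lambda>p. \<integral>\<^sup>+t. indicator A (flow (p, t)) \<partial>lborel) \<in> borel_measurable borel"
      by (rule lborel.borel_measurable_nn_integral)
  qed
  also have "\<dots> = (\<integral>\<^sup>+b. \<integral>\<^sup>+x. indicator A (b, geod b (fst x) (snd x)) \<partial>lborel \<partial>lborel)"
    by (intro nn_integral_cong, subst nn_integral_lborel_fst) (measurable, simp add: flow_def)
  also have "\<dots> = (\<integral>\<^sup>+b. \<integral>\<^sup>+z. indicator A (b, z) * ennreal (flow_density (b, z)) \<partial>lborel \<partial>lborel)"
    by (intro nn_integral_cong, subst nn_integral_geod) (measurable, simp add: flow_density_def)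
  also have "\<dots> = (\<integral>\<^sup>+p. indicator A p * ennreal (flow_density p) \<partial>lborel)"
    by (rule nn_integral_lborel_fst[symmetric]) measurable
  also have "\<dots> = emeasure ?N A"
    by (subst emeasure_density) (auto simp: mult.commute)
  finally show "emeasure ?M A = emeasure ?N A" .
qed simp

text \<open>Cauchy's formula yields gauge integrals over the closed period. Domination by the weight
  of \<open>fan_coord_weight_integral\<close> gives Lebesgue integrability, and the endpoint
  \<open>2 * pi\<close> is negligible.\<close>

lemma has_integral_Ico_lebesgue:
  fixes f :: "real \<Rightarrow> complex"
  assumes f [measurable]: "f \<in> borel_measurable borel" and z: "cmod z < 1"
    and int: "(f has_integral I) {0..2*pi}"
    and le: "\<And>b. cmod (f b) \<le> C * (poisson b z / (1 + (fan_coord b z)\<^sup>2))"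
  shows "(LINT b:{0..<2*pi}|lborel. f b) = I"
proof -
  have nn: "(\<integral>\<^sup>+b. ennreal (indicator {0..2*pi} b * (poisson b z / (1 + (fan_coord b z)\<^sup>2))) \<partial>lborel) = ennreal (2 * pi * bdf z)"
    using fan_coord_weight_integral[OF z] poisson_pos[OF z] one_plus_sq_pos
    by (intro nn_integral_has_integral_lebesgue) (auto intro!: divide_nonneg_nonneg less_imp_le)
  have "set_integrable lborel {0..2*pi} (\<lambda>b. poisson b z / (1 + (fan_coord b z)\<^sup>2))"
    unfolding set_integrable_def
  proof (rule integrableI_nonneg)
    show "AE b in lborel. 0 \<le> indicat_real {0..2*pi} b *\<^sub>R (poisson b z / (1 + (fan_coord b z)\<^sup>2))"
    proof (rule AE_I2)
      fix b show "0 \<le> indicat_real {0..2*pi} b *\<^sub>R (poisson b z / (1 + (fan_coord b z)\<^sup>2))"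
        using poisson_pos[OF z, of b] by (intro scaleR_nonneg_nonneg divide_nonneg_nonneg) auto
    qed
    show "(\<integral>\<^sup>+b. ennreal (indicat_real {0..2*pi} b *\<^sub>R (poisson b z / (1 + (fan_coord b z)\<^sup>2))) \<partial>lborel) < \<infinity>"
      using nn by simp
  qed measurable
  then have "set_integrable lborel {0..2*pi} (\<lambda>b. C * (poisson b z / (1 + (fan_coord b z)\<^sup>2)))"
    by (rule set_integrable_mult_right)
  then have "set_integrable lborel {0..2*pi} f"
    by (rule set_integrable_bound) 
      (simp add: set_borel_measurable_def, intro AE_I2 impI, unfold real_norm_def, rule order_trans[OF le abs_ge_self])
  then have "set_integrable lborel {0..<2*pi} f"
    by (rule set_integrable_subset) auto
  then have "(LINT b:{0..<2*pi}|lborel. f b) = integral {0..<2*pi} f"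
    by (rule set_borel_integral_eq_integral)
  also have "(f has_integral I) {0..<2*pi}"
    using int by (rule has_integral_spike_set_eq[THEN iffD1, rotated 2])
      (auto intro: negligible_subset[of "{2*pi}"])
  then have "integral {0..<2*pi} f = I" by (rule integral_unique)
  finally show ?thesis .
qed

text \<open>Santalo's formula exchanges rays for fibres, and Fubini is justified by integrating the
  modulus over the fibre: the bound on \<open>G\<close> averages to \<open>bdf\<close>, leaving the
  integral that \<open>admissible\<close> makes finite. The third claim is the almost-everywhere
  part of Fubini.\<close>

lemma xray_pairing:
  fixes D :: "real \<times> complex \<Rightarrow> complex" and G :: "real \<times> real \<Rightarrow> complex"
  assumes H: "admissible H"
    and D [measurable]: "D \<in> borel_measurable borel" and D_le: "\<And>b z. cmod z < 1 \<Longrightarrow> cmod (D (b, z)) \<le> 1"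
    and G [measurable]: "G \<in> borel_measurable borel" and G_le: "\<And>b a. cmod (G (b, a)) \<le> C * (1 / (1 + a\<^sup>2))"
  defines "F \<equiv> \<lambda>p t. H (geod (fst p) (snd p) t) * D (fst p, geod (fst p) (snd p) t)"
    and "B \<equiv> {0..<2*pi} \<times> UNIV"
  shows "set_integrable lborel B (\<lambda>p. (LINT t|lborel. F p t) * G p)" (is ?A)
    and "(LINT p:B|lborel. (LINT t|lborel. F p t) * G p) =
      (LINT z:ball 0 1|lborel. H z / (cfac z)\<^sup>2 * (LINT b:{0..<2*pi}|lborel. D (b, z) * G (b, fan_coord b z) * poisson b z))"
      (is ?B)
    and "AE p in lborel. p \<in> B \<longrightarrow> integrable lborel (\<lambda>t. F p t * G p)" (is ?C)
proof -
  have C: "C \<ge> 0" using order_trans[OF norm_ge_zero G_le[of 0 0]] by simp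
  have [measurable]: "H \<in> borel_measurable borel"
    and Hint: "set_integrable lborel (ball 0 1) (\<lambda>z. cmod (H z) * bdf z / (cfac z)\<^sup>2)"
    using H by (simp_all add: admissible_def)
  \<comment> \<open>The full integrand as a function of endpoint and foot point.
    \<open>fan_coord\<close> is constant along each geodesic, so \<open>G\<close> can be evaluated
    there.\<close>
  define W where "W = (\<lambda>p :: real \<times> complex. indicator {0..<2*pi} (fst p) *\<^sub>R (H (snd p) * D p * G (fst p, fan_coord (fst p) (snd p))))"
  have W [measurable]: "W \<in> borel_measurable borel"
    unfolding W_def by measurable
  have W_flow: "W (flow (p, t)) = indicator B p *\<^sub>R (F p t * G p)" for p t
    by (simp add: W_def flow_def F_def B_def indicator_times)
  have bound: "norm (flow_density (b, z) *\<^sub>R W (b, z)) \<le>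
      (indicator (ball 0 1) z * (C * cmod (H z) / (cfac z)\<^sup>2)) * (indicator {0..2*pi} b * (poisson b z / (1 + (fan_coord b z)\<^sup>2)))" for b z
  proof (cases "b \<in> {0..<2*pi} \<and> cmod z < 1")
    case True
    have "norm (flow_density (b, z) *\<^sub>R W (b, z)) = poisson b z / (cfac z)\<^sup>2 * (cmod (H z) * cmod (D (b, z)) * cmod (G (b, fan_coord b z)))"
      using True poisson_pos[of z b] by (simp add: flow_density_def W_def norm_mult)
    also have "\<dots> \<le> poisson b z / (cfac z)\<^sup>2 * (cmod (H z) * 1 * (C * (1 / (1 + (fan_coord b z)\<^sup>2))))"
      using True poisson_pos[of z b] C one_plus_sq_pos[of "fan_coord b z"]
      by (intro mult_left_mono mult_mono D_le G_le divide_nonneg_nonneg) (auto intro!: mult_nonneg_nonneg)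
    also have "\<dots> = (indicator (ball 0 1) z * (C * cmod (H z) / (cfac z)\<^sup>2)) * (indicator {0..2*pi} b * (poisson b z / (1 + (fan_coord b z)\<^sup>2)))"
      using True by simp
    finally show ?thesis .
  next
    case False
    then have "flow_density (b, z) *\<^sub>R W (b, z) = 0"
      by (auto simp: flow_density_def W_def)
    moreover have "0 \<le> (indicator (ball 0 1) z * (C * cmod (H z) / (cfac z)\<^sup>2)) * (indicator {0..2*pi} b * (poisson b z / (1 + (fan_coord b z)\<^sup>2)))"
      using poisson_pos[of z b] C by (auto simp: indicator_def)
    ultimately show ?thesis by (simp only: norm_zero)
  qed
  have int: "integrable lborel (\<lambda>p. flow_density p *\<^sub>R W p)"
  proof (rule integrableI_bounded)
    have "(\<integral>\<^sup>+p. ennreal (norm (flow_density p *\<^sub>R W p)) \<partial>lborel) =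
        (\<integral>\<^sup>+z. \<integral>\<^sup>+b. ennreal (norm (flow_density (b, z) *\<^sub>R W (b, z))) \<partial>lborel \<partial>lborel)"
      by (rule nn_integral_lborel_snd) measurable
    also have "\<dots> \<le> (\<integral>\<^sup>+z. \<integral>\<^sup>+b. ennreal (indicator (ball 0 1) z * (C * cmod (H z) / (cfac z)\<^sup>2)) *
        ennreal (indicator {0..2*pi} b * (poisson b z / (1 + (fan_coord b z)\<^sup>2))) \<partial>lborel \<partial>lborel)"
      using C by (intro nn_integral_mono)
        (simp add: ennreal_mult'[symmetric], intro ennreal_leI, use bound in simp)
    also have "\<dots> = (\<integral>\<^sup>+z. ennreal (indicator (ball 0 1) z *\<^sub>R (2 * pi * C * (cmod (H z) * bdf z / (cfac z)\<^sup>2))) \<partial>lborel)"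
    proof (rule nn_integral_cong)
      fix z :: complex
      show "(\<integral>\<^sup>+b. ennreal (indicator (ball 0 1) z * (C * cmod (H z) / (cfac z)\<^sup>2)) *
          ennreal (indicator {0..2*pi} b * (poisson b z / (1 + (fan_coord b z)\<^sup>2))) \<partial>lborel) =
        ennreal (indicator (ball 0 1) z *\<^sub>R (2 * pi * C * (cmod (H z) * bdf z / (cfac z)\<^sup>2)))"
      proof (cases "cmod z < 1")
        case True
        have "(\<integral>\<^sup>+b. ennreal (indicator {0..2*pi} b * (poisson b z / (1 + (fan_coord b z)\<^sup>2))) \<partial>lborel) = ennreal (2 * pi * bdf z)"
          using fan_coord_weight_integral[OF True] poisson_pos[OF True] one_plus_sq_pos
          by (intro nn_integral_has_integral_lebesgue) (auto intro!: divide_nonneg_nonneg less_imp_le)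
        then show ?thesis
          using True C bdf_pos[OF True]
          by (subst nn_integral_cmult) (auto simp: ennreal_mult'[symmetric] mult_ac)
      qed simp
    qed
    also have "\<dots> < \<infinity>"
    proof -
      have "integrable lborel (\<lambda>z. indicator (ball 0 1) z *\<^sub>R (2 * pi * C * (cmod (H z) * bdf z / (cfac z)\<^sup>2)))"
        using set_integrable_mult_right[OF Hint, of "2 * pi * C"] by (simp add: set_integrable_def)
      moreover have "0 \<le> indicator (ball 0 1) z *\<^sub>R (2 * pi * C * (cmod (H z) * bdf z / (cfac z)\<^sup>2))" for z :: complex
        using C bdf_pos[of z] by (auto simp: indicator_def intro!: mult_nonneg_nonneg divide_nonneg_nonneg)
      ultimately show ?thesis
        by (simp add: nn_integral_eq_integral)
    qed
    finally show "(\<integral>\<^sup>+p. ennreal (norm (flow_density p *\<^sub>R W p)) \<partial>lborel) < \<infinity>" .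
  qed measurable
  have "integrable (density lborel flow_density) W"
    using int by (subst integrable_density) (auto simp: flow_density_nonneg)
  \<comment> \<open>Integrability is pulled back from the fibre side to the product of geodesics and
    time.\<close>
  then have int3: "integrable (lborel \<Otimes>\<^sub>M lborel) (\<lambda>x. W (flow x))"
    unfolding santalo_formula[symmetric] lborel_prod by (subst (asm) integrable_distr_eq) auto
  have "AE p in lborel. integrable lborel (\<lambda>t. W (flow (p, t)))"
    by (rule lborel_pair.AE_integrable_fst'[OF int3])
  then show ?C
    unfolding W_flow by eventually_elim auto
  have int2: "integrable lborel (\<lambda>p. LINT t|lborel. W (flow (p, t)))"
    by (rule lborel_pair.integrable_fst'[OF int3])
  have eq: "(LINT t|lborel. W (flow (p, t))) = indicator B p *\<^sub>R ((LINT t|lborel. F p t) * G p)" for p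
    by (simp add: W_flow)
  show ?A
    using int2 unfolding eq set_integrable_def .
  have "(LINT p:B|lborel. (LINT t|lborel. F p t) * G p) = (LINT p|lborel. LINT t|lborel. W (flow (p, t)))"
    unfolding eq set_lebesgue_integral_def ..
  also have "\<dots> = (LINT x|(lborel \<Otimes>\<^sub>M lborel). W (flow x))"
    by (rule lborel_pair.integral_fst'[OF int3])
  also have "\<dots> = integral\<^sup>L (distr lborel borel flow) W"
    unfolding lborel_prod by (rule integral_distr[symmetric]) auto
  also have "\<dots> = (LINT p|lborel. flow_density p *\<^sub>R W p)"
    unfolding santalo_formula by (rule integral_density) (auto simp: flow_density_nonneg)
  also have "\<dots> = (LINT z|lborel. LINT b|lborel. flow_density (b, z) *\<^sub>R W (b, z))"
    using lborel_pair.integral_snd[of "\<lambda>b z. flow_density (b, z) *\<^sub>R W (b, z)"] int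
    by (simp add: lborel_prod case_prod_beta')
  also have "\<dots> = (LINT z:ball 0 1|lborel. H z / (cfac z)\<^sup>2 * (LINT b:{0..<2*pi}|lborel. D (b, z) * G (b, fan_coord b z) * poisson b z))"
    unfolding set_lebesgue_integral_def
  proof (rule Bochner_Integration.integral_cong[OF refl])
    fix z :: complex
    have "flow_density (b, z) *\<^sub>R W (b, z) = (indicator (ball 0 1) z *\<^sub>R (H z / (cfac z)\<^sup>2)) *
        (indicator {0..<2*pi} b *\<^sub>R (D (b, z) * G (b, fan_coord b z) * poisson b z))" for b
      by (simp add: flow_density_def W_def indicator_def scaleR_conv_of_real mult_ac)
    then show "(LINT b|lborel. flow_density (b, z) *\<^sub>R W (b, z)) = indicator (ball 0 1) z *\<^sub>R
        (H z / (cfac z)\<^sup>2 * (LINT b|lborel. indicator {0..<2*pi} b *\<^sub>R (D (b, z) * G (b, fan_coord b z) * poisson b z)))"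
      by (simp only: integral_mult_right_zero mult_scaleR_left integral_scaleR_right)
  qed
  finally show ?B .
qed

subsection \<open>Weighted Bergman reproducing formula\<close>

lemma moeb_involution:
  assumes "cmod w < 1" "cmod x < 1"
  shows "moeb (cnj w) (moeb (cnj w) x) = x"
proof -
  have 1: "1 - cnj w * x \<noteq> 0" using one_minus_mult_nz[of "cnj w" x] assms by simp
  have 2: "1 - cnj w * w \<noteq> 0" using one_minus_mult_nz[of "cnj w" w] assms by simp
  have "w - (w - x) / (1 - cnj w * x) = x * (1 - cnj w * w) / (1 - cnj w * x)"
    using 1 by (simp add: field_simps)
  moreover have "1 - cnj w * ((w - x) / (1 - cnj w * x)) = (1 - cnj w * w) / (1 - cnj w * x)"
    using 1 by (simp add: field_simps)
  ultimately show ?thesis using 1 2 by (simp add: moeb_def)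
qed

lemma moeb_norm_less:
  assumes "cmod z < 1" "cmod u < 1"
  shows "cmod (moeb z u) < 1"
proof -
  have "1 - z * u \<noteq> 0" using one_minus_mult_nz[of z u] assms by simp
  then have "0 < 1 - (cmod (moeb z u))\<^sup>2"
    using assms by (subst moeb_norm_identity) (auto simp: power_less_one_iff intro!: divide_pos_pos)
  then show ?thesis by (simp add: power_less_one_iff abs_square_less_1)
qed

lemma radial_integral:
  "(LINT r:{0<..<1}|lborel. r * (1 - r\<^sup>2) ^ n) = 1 / (2 * real (Suc n))"
proof -
  let ?f = "\<lambda>r::real. r * (1 - r\<^sup>2) ^ n"
  let ?F = "\<lambda>r::real. - ((1 - r\<^sup>2) ^ Suc n) / (2 * real (Suc n))"
  have "(?F has_real_derivative ?f r) (at r within {0..1})" for r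
  proof -
    have "(?F has_real_derivative - (real (Suc n) * (1 - r\<^sup>2) ^ n * (- (2 * r))) / (2 * real (Suc n))) (at r within {0..1})"
      by (rule derivative_eq_intros refl | simp)+
    moreover have "- (real (Suc n) * y * (- (2 * r))) / (2 * real (Suc n)) = r * y" for y
      by (simp add: field_simps del: of_nat_Suc)
    ultimately show ?thesis by (simp only:)
  qed
  then have "(?f has_integral (?F 1 - ?F 0)) {0..1}"
    by (intro fundamental_theorem_of_calculus) (auto simp: has_real_derivative_iff_has_vector_derivative)
  then have "integral {0..1} ?f = 1 / (2 * real (Suc n))"
    by (subst integral_unique) auto
  moreover have "set_integrable lborel {0..1} ?f"
    by (intro borel_integrable_atLeastAtMost') (intro continuous_intros)
  then have "set_integrable lborel {0<..<1} ?f"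
    by (rule set_integrable_subset) auto
  then have "(LINT r:{0<..<1}|lborel. ?f r) = integral {0<..<1} ?f"
    by (rule set_borel_integral_eq_integral)
  ultimately show ?thesis
    by (simp add: integral_open_interval_real)
qed

text \<open>This is \<open>poisson_integral\<close> at the centre, where \<open>poisson\<close> is 1
  and \<open>fan_coord\<close> is 0, so that a constant bound suffices.\<close>

lemma mean_value_circle:
  fixes F :: "complex \<Rightarrow> complex" and r :: real
  assumes hol: "F holomorphic_on ball 0 1" and r: "0 < r" "r < 1"
  shows "(LINT b:{0..<2*pi}|lborel. F (r * cis (- b))) = 2 * pi * F 0"
proof -
  have im: "(\<lambda>u::complex. r * u) ` cball 0 1 \<subseteq> ball 0 1"
  proof (rule image_subsetI)
    fix u :: complex assume "u \<in> cball 0 1"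
    then have "r * cmod u \<le> r * 1" using r by (intro mult_left_mono) auto
    also have "\<dots> < 1" using r by simp
    finally show "r * u \<in> ball 0 1" using r by (simp add: norm_mult)
  qed
  have "F \<circ> (\<lambda>u::complex. r * u) holomorphic_on cball 0 1"
    by (rule holomorphic_on_compose_gen[OF _ hol im]) (intro holomorphic_intros)
  then have h: "(\<lambda>u::complex. F (r * u)) holomorphic_on cball 0 1" by (simp add: o_def)
  then have cont: "continuous_on (cball 0 1) (\<lambda>u::complex. F (r * u))"
    by (rule holomorphic_on_imp_continuous_on)
  have "compact ((\<lambda>u::complex. F (r * u)) ` cball 0 1)"
    by (rule compact_continuous_image[OF cont]) simp
  then obtain C where C: "\<And>u :: complex. cmod u \<le> 1 \<Longrightarrow> cmod (F (r * u)) \<le> C"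
    by (force dest!: compact_imp_bounded simp: bounded_iff)
  have "continuous_on UNIV (\<lambda>b. F (r * cis (- b)))"
    by (rule continuous_on_compose2[OF cont]) (auto intro!: continuous_intros)
  then have meas: "(\<lambda>b. F (r * cis (- b))) \<in> borel_measurable borel"
    by (rule borel_measurable_continuous_onI)
  have int: "((\<lambda>b. F (r * cis (- b))) has_integral 2 * pi * F 0) {0..2*pi}"
    using poisson_integral[OF h, of 0] by (simp add: poisson_def)
  show ?thesis
    by (rule has_integral_Ico_lebesgue[OF meas _ int, of 0 C]) (use C in \<open>simp_all add: poisson_def fan_coord_def\<close>)
qed

lemma cis_uminus_inj:
  assumes "cis (- s) = cis (- t)" "s \<in> {0..<2*pi}" "t \<in> {0..<2*pi}"
  shows "s = t"
proof -
  have "cnj (cis s) = cnj (cis t)" using assms(1) by (simp only: cis_cnj)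
  then have "cis s = cis t" by (simp only: complex_cnj_cancel_iff)
  moreover have "Arg2pi (cis x) = x" if "x \<in> {0..<2*pi}" for x
    by (rule Arg2pi_unique[of 1]) (use that in \<open>simp_all add: cis_conv_exp\<close>)
  ultimately show ?thesis using assms(2,3) by metis
qed

text \<open>The disk minus \<open>w\<close> in polar coordinates centred at \<open>w\<close>, transported by the involution exchanging
  \<open>0\<close> and \<open>w\<close>; the weight becomes radial and the kernel becomes holomorphic.\<close>

lemma bergman_reproducing:
  fixes f :: "complex \<Rightarrow> complex"
  assumes hol: "f holomorphic_on ball 0 1" and f [measurable]: "f \<in> borel_measurable borel"
    and int: "set_integrable lborel (ball 0 1) (\<lambda>z. f z * (1 - z * cnj z) ^ n)"
    and w: "cmod w < 1"
  shows "(LINT z:ball 0 1|lborel. f z * (1 - z * cnj z) ^ n / (1 - cnj z * w) ^ (n + 2)) = pi / real (Suc n) * f w"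
proof -
  define m where "m = moeb (cnj w)"
  \<comment> \<open>Radius 0 is excluded and the angle is half-open, which makes polar coordinates
    injective; the image misses only the null set \<open>{w}\<close>.\<close>
  define S where "S = {0<..<1::real} \<times> {0..<2*pi}"
  define g where "g = (\<lambda>x::real\<times>real. m (complex_of_real (fst x) * cis (- snd x)))"
  define c where "c = 1 - (cmod w)\<^sup>2"
  define J where "J = (\<lambda>x::real\<times>real. (c / (cmod (1 - cnj w * (complex_of_real (fst x) * cis (- snd x))))\<^sup>2)\<^sup>2 * fst x)"
  define h where "h = (\<lambda>z. f z * (1 - z * cnj z) ^ n / (1 - cnj z * w) ^ (n + 2))"
  \<comment> \<open>What remains of the integrand besides the radial weight; it is holomorphic in
    the disk and \<open>F 0 = f w\<close>.\<close>
  define F where "F = (\<lambda>u. f (m u) / (1 - cnj w * u) ^ (n + 2))"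
  have c: "c > 0" "complex_of_real c = 1 - cnj w * w"
    using w by (simp_all add: c_def power_less_one_iff complex_norm_square mult.commute del: of_real_power)
  have nz: "1 - cnj w * u \<noteq> 0" if "cmod u < 1" for u
    using one_minus_mult_nz[of "cnj w" u] w that by simp
  have S [measurable]: "S \<in> sets borel" unfolding S_def by (intro borel_Times) auto
  have [measurable]: "g \<in> borel_measurable borel" "J \<in> borel_measurable borel" "h \<in> borel_measurable borel"
    unfolding g_def J_def h_def m_def moeb_def by measurable
  have S_norm: "cmod (complex_of_real (fst x) * cis (- snd x)) < 1" if "x \<in> S" for x
    using that by (auto simp: S_def norm_mult)
  have inj: "inj_on g S"
  proof (rule inj_onI)
    fix x y assume x: "x \<in> S" and y: "y \<in> S" and "g x = g y"
    then have eq: "complex_of_real (fst x) * cis (- snd x) = complex_of_real (fst y) * cis (- snd y)"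
      unfolding g_def m_def using moeb_involution[OF w] S_norm by metis
    then have "cmod (complex_of_real (fst x) * cis (- snd x)) = cmod (complex_of_real (fst y) * cis (- snd y))" by simp
    then have 1: "fst x = fst y" using x y by (auto simp: S_def norm_mult)
    with eq x have "cis (- snd x) = cis (- snd y)" by (auto simp: S_def)
    then have "snd x = snd y" by (rule cis_uminus_inj) (use x y in \<open>auto simp: S_def\<close>)
    with 1 show "x = y" by (simp add: prod_eq_iff)
  qed
  have im: "g ` S = ball 0 1 - {w}"
  proof (intro equalityI subsetI)
    fix z assume "z \<in> g ` S"
    then obtain x where x: "x \<in> S" "z = g x" by auto
    have "cmod z < 1" unfolding x g_def m_def using moeb_norm_less S_norm[OF x(1)] w by simp
    moreover have "z \<noteq> w"
    proof
      assume "z = w"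
      then have "moeb (cnj w) w = complex_of_real (fst x) * cis (- snd x)"
        using x moeb_involution[OF w S_norm[OF x(1)]] by (simp add: g_def m_def)
      then show False using x(1) by (auto simp: moeb_def S_def)
    qed
    ultimately show "z \<in> ball 0 1 - {w}" by simp
  next
    fix z assume "z \<in> ball 0 1 - {w}"
    then have z: "cmod z < 1" "z \<noteq> w" by auto
    let ?u = "m z"
    have u1: "cmod ?u < 1" using moeb_norm_less[of "cnj w" z] z w by (simp add: m_def)
    have mu: "m ?u = z" using moeb_involution[OF w z(1)] by (simp add: m_def)
    have u0: "?u \<noteq> 0" using nz[OF z(1)] z(2) by (simp add: m_def moeb_def)
    have "cnj ?u = complex_of_real (cmod ?u) * cis (Arg2pi (cnj ?u))"
      using Arg2pi_eq[of "cnj ?u"] by (simp add: cis_conv_exp)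
    then have "?u = complex_of_real (cmod ?u) * cis (- Arg2pi (cnj ?u))"
      by (metis cis_cnj complex_cnj_cnj complex_cnj_complex_of_real complex_cnj_mult)
    then have "z = g (cmod ?u, Arg2pi (cnj ?u))" using mu by (simp add: g_def)
    moreover have "(cmod ?u, Arg2pi (cnj ?u)) \<in> S"
      using u0 u1 Arg2pi[of "cnj ?u"] by (simp add: S_def)
    ultimately show "z \<in> g ` S" by blast
  qed
  have gS: "g ` S \<in> sets borel" unfolding im by measurable
  let ?z = "\<lambda>x::real\<times>real. complex_of_real (fst x) * cis (- snd x)"
  let ?dm = "\<lambda>x. - complex_of_real c / (1 - cnj w * ?z x)\<^sup>2"
  let ?g' = "\<lambda>x v. ?dm x * (complex_of_real (fst v) * cis (- snd x) + complex_of_real (- fst x * snd v) * (\<i> * cis (- snd x)))"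
  have der: "(g has_derivative ?g' x) (at x within S)" if "x \<in> S" for x
  proof -
    have "(?z has_derivative (\<lambda>v. complex_of_real (fst v) * cis (- snd x) + complex_of_real (- fst x * snd v) * (\<i> * cis (- snd x)))) (at x within S)"
      by (auto intro!: derivative_eq_intros simp: fun_eq_iff scaleR_conv_of_real algebra_simps)
    moreover have "(m has_field_derivative ?dm x) (at (?z x))"
      unfolding m_def moeb_def using nz[OF S_norm[OF that]]
      by (auto intro!: derivative_eq_intros simp: c(2) power2_eq_square algebra_simps)
    ultimately show ?thesis
      unfolding g_def by (rule has_derivative_compose[OF _ has_field_derivative_imp_has_derivative])
  qed
  have J: "\<bar>Im (cnj (?g' x (1,0)) * ?g' x (0,1))\<bar> = J x" if "x \<in> S" for x
  proof -
    have "cnj (?g' x (1,0)) * ?g' x (0,1) = (?dm x * cnj (?dm x)) * (cis (- snd x) * cnj (cis (- snd x))) * (- (\<i> * fst x))"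
      by (simp add: mult_ac)
    also have "\<dots> = complex_of_real ((cmod (?dm x))\<^sup>2) * complex_of_real ((cmod (cis (- snd x)))\<^sup>2) * (- (\<i> * fst x))"
      by (simp only: complex_norm_square)
    finally have "\<bar>Im (cnj (?g' x (1,0)) * ?g' x (0,1))\<bar> = (cmod (?dm x))\<^sup>2 * fst x"
      using that by (cases x) (simp add: S_def abs_mult)
    then show ?thesis
      using c(1) by (simp add: J_def norm_divide norm_power)
  qed
  \<comment> \<open>With \<open>q = 1 - cnj w * u\<close>, the Jacobian contributes
    \<open>(q * cnj q)^(-2)\<close>, the weight \<open>(q * cnj q)^(-n)\<close> and the kernel
    \<open>(cnj q)^(n + 2)\<close>. All powers of \<open>cnj q\<close> and of \<open>c\<close>
    cancel, so the angular dependence is holomorphic.\<close>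
  have Jh: "J x *\<^sub>R h (g x) = (fst x * (1 - (fst x)\<^sup>2) ^ n) *\<^sub>R F (?z x)" if x: "x \<in> S" for x
  proof -
    let ?u = "?z x"
    define q where "q = 1 - cnj w * ?u"
    have q: "q \<noteq> 0" using nz[OF S_norm[OF x]] by (simp add: q_def)
    have u: "?u * cnj ?u = complex_of_real ((fst x)\<^sup>2)"
      by (simp add: cis_cnj cis_mult power2_eq_square)
    have "complex_of_real (1 - (cmod (m ?u))\<^sup>2) = complex_of_real (c * (1 - (fst x)\<^sup>2) / (cmod q)\<^sup>2)"
      using moeb_norm_identity[of "cnj w" ?u] S_norm[OF x] w
      by (simp add: m_def c_def q_def norm_mult)
    then have A: "1 - m ?u * cnj (m ?u) = complex_of_real c * complex_of_real (1 - (fst x)\<^sup>2) / (q * cnj q)"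
      by (simp add: complex_norm_square del: of_real_power)
    have B: "1 - cnj (m ?u) * w = complex_of_real c / cnj q"
    proof -
      have "1 - p / Q * w = (Q - p * w) / Q" if "Q \<noteq> 0" for p Q :: complex
        using that by (simp add: field_simps)
      moreover have "cnj (m ?u) = cnj (w - ?u) / cnj q"
        by (simp add: m_def moeb_def q_def)
      moreover have "cnj q \<noteq> 0" using q by simp
      ultimately have "1 - cnj (m ?u) * w = (cnj q - cnj (w - ?u) * w) / cnj q"
        by (simp only:)
      also have "cnj q - cnj (w - ?u) * w = complex_of_real c"
        by (simp add: q_def c(2) algebra_simps)
      finally show ?thesis .
    qed
    have Jq: "complex_of_real (J x) = (complex_of_real c / (q * cnj q))\<^sup>2 * fst x"
      by (simp only: J_def q_def[symmetric] complex_norm_square[symmetric] of_real_mult of_real_divide of_real_power)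
    have gen: "(C / (q * q'))\<^sup>2 * R * (f' * (C * s / (q * q')) ^ n / (C / q') ^ (n + 2)) = R * s ^ n * (f' / q ^ (n + 2))"
      if "q' \<noteq> 0" "C \<noteq> 0" for C q' R s f' :: complex
      using that q by (simp add: power_divide power_mult_distrib power_add field_simps power2_eq_square)
    have "complex_of_real (J x) * h (g x) = complex_of_real (fst x) * complex_of_real (1 - (fst x)\<^sup>2) ^ n * (f (m ?u) / q ^ (n + 2))"
      unfolding h_def g_def A B Jq by (rule gen) (use q c in auto)
    then show ?thesis by (simp add: scaleR_conv_of_real F_def q_def)
  qed
  have Fhol: "F holomorphic_on ball 0 1"
  proof -
    have "m holomorphic_on ball 0 1"
      unfolding m_def by (rule holomorphic_on_subset[OF moeb_holomorphic]) (use w in auto)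
    moreover have "m ` ball 0 1 \<subseteq> ball 0 1"
      using moeb_norm_less[of "cnj w"] w by (auto simp: m_def)
    ultimately have "f \<circ> m holomorphic_on ball 0 1"
      by (intro holomorphic_on_compose_gen[OF _ hol])
    then have "(\<lambda>u. f (m u)) holomorphic_on ball 0 1" by (simp add: o_def)
    then show ?thesis unfolding F_def using nz by (intro holomorphic_intros) auto
  qed
  \<comment> \<open>For fixed \<open>w\<close> the kernel is bounded because
    \<open>|1 - cnj z * w| \<ge> 1 - |w|\<close>.\<close>
  have hint: "set_integrable lborel (ball 0 1) h"
  proof -
    have "set_integrable lborel (ball 0 1) (\<lambda>z. (1 / (1 - cmod w) ^ (n + 2)) *\<^sub>R (f z * (1 - z * cnj z) ^ n))"
      using int by simp
    then show ?thesis
    proof (rule set_integrable_bound)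
      show "AE z in lborel. z \<in> ball 0 1 \<longrightarrow> cmod (h z) \<le> cmod ((1 / (1 - cmod w) ^ (n + 2)) *\<^sub>R (f z * (1 - z * cnj z) ^ n))"
      proof (intro AE_I2 impI)
        fix z :: complex assume "z \<in> ball 0 1"
        then have z: "cmod z < 1" by simp
        have "cmod (cnj z * w) \<le> 1 * cmod w" 
          unfolding norm_mult complex_mod_cnj using z by (intro mult_right_mono) auto
        then have "1 - cmod w \<le> cmod (1 - cnj z * w)"
          using norm_triangle_ineq2[of 1 "cnj z * w"] by simp
        then have "(1 - cmod w) ^ (n + 2) \<le> cmod (1 - cnj z * w) ^ (n + 2)"
          using w by (intro power_mono) auto
        moreover have "(1 - cmod w) ^ (n + 2) > 0" using w by simp
        ultimately have "cmod (f z * (1 - z * cnj z) ^ n) / cmod (1 - cnj z * w) ^ (n + 2) \<le>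
            cmod (f z * (1 - z * cnj z) ^ n) / (1 - cmod w) ^ (n + 2)"
          by (intro divide_left_mono) auto
        then show "cmod (h z) \<le> cmod ((1 / (1 - cmod w) ^ (n + 2)) *\<^sub>R (f z * (1 - z * cnj z) ^ n))"
          using w by (simp add: h_def norm_divide norm_power del: add_2_eq_Suc')
      qed
    qed (simp add: set_borel_measurable_def)
  qed
  then have "set_integrable lborel (g ` S) h"
    unfolding im by (rule set_integrable_subset) auto
  then have "set_integrable lborel S (\<lambda>x. J x *\<^sub>R h (g x))"
    by (subst integral_change_of_variables_complex(1)[OF S gS _ der inj J]) simp_all
  then have Sint: "integrable (lborel \<Otimes>\<^sub>M lborel) (\<lambda>x. indicator S x *\<^sub>R (J x *\<^sub>R h (g x)))"
    by (simp add: set_integrable_def lborel_prod)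
  have "(LINT z:ball 0 1|lborel. h z) = (LINT z:g ` S|lborel. h z)"
    unfolding set_lebesgue_integral_def
  proof (rule integral_cong_AE)
    show "AE z in lborel. indicat_real (ball 0 1) z *\<^sub>R h z = indicat_real (g ` S) z *\<^sub>R h z"
      using AE_lborel_singleton[of w] by eventually_elim (simp add: im indicator_def)
  qed (use gS in measurable)
  also have "\<dots> = (LINT x:S|lborel. J x *\<^sub>R h (g x))"
    by (rule integral_change_of_variables_complex(2)[OF S gS _ der inj J, symmetric]) simp_all
  also have "\<dots> = (LINT r|lborel. LINT b|lborel. indicator S (r, b) *\<^sub>R (J (r, b) *\<^sub>R h (g (r, b))))"
    unfolding set_lebesgue_integral_def using lborel_pair.integral_fst'[OF Sint] by (simp add: lborel_prod)
  also have "\<dots> = (LINT r|lborel. (indicator {0<..<1} r *\<^sub>R (r * (1 - r\<^sup>2) ^ n)) *\<^sub>R (2 * pi * F 0))"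
  proof (rule Bochner_Integration.integral_cong[OF refl])
    fix r :: real
    have eq: "indicator S (r, b) *\<^sub>R (J (r, b) *\<^sub>R h (g (r, b))) =
        (indicator {0<..<1} r *\<^sub>R (r * (1 - r\<^sup>2) ^ n)) *\<^sub>R (indicator {0..<2*pi} b *\<^sub>R F (r * cis (- b)))" for b
      using Jh[of "(r, b)"] by (auto simp: indicator_def S_def)
    show "(LINT b|lborel. indicator S (r, b) *\<^sub>R (J (r, b) *\<^sub>R h (g (r, b)))) =
        (indicator {0<..<1} r *\<^sub>R (r * (1 - r\<^sup>2) ^ n)) *\<^sub>R (2 * pi * F 0)"
      unfolding eq integral_scaleR_right using mean_value_circle[OF Fhol, of r]
      by (cases "0 < r \<and> r < 1") (auto simp: set_lebesgue_integral_def)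
  qed
  also have "\<dots> = (LINT r:{0<..<1}|lborel. r * (1 - r\<^sup>2) ^ n) *\<^sub>R (2 * pi * F 0)"
    unfolding set_lebesgue_integral_def scaleR_conv_of_real[where 'a=complex]
    by (simp only: integral_mult_left_zero integral_complex_of_real)
  also have "\<dots> = pi / real (Suc n) * f w"
  proof -
    have "(1 / (2 * s)) *\<^sub>R (2 * pi * y) = pi / s * y" for s :: real and y :: complex
      by (simp add: scaleR_conv_of_real)
    moreover have "F 0 = f w" by (simp add: F_def m_def moeb_def)
    ultimately show ?thesis unfolding radial_integral by (simp only:)
  qed
  finally show ?thesis by (simp add: h_def)
qed

subsection \<open>Recovery of the trace-free parts\<close>

definition ray_integral :: "(complex \<Rightarrow> complex) \<Rightarrow> (real \<times> complex \<Rightarrow> complex) \<Rightarrow> real \<times> real \<Rightarrow> complex" where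
  "ray_integral H D p = (LINT t|lborel. H (geod (fst p) (snd p) t) * D (fst p, geod (fst p) (snd p) t))"

text \<open>Common treatment of powers of the direction and of its conjugate; the bound is asked
  only in the disk, where directions are unimodular.\<close>

definition direction_factor :: "(real \<times> complex \<Rightarrow> complex) \<Rightarrow> bool" where
  "direction_factor D \<longleftrightarrow> D \<in> borel_measurable borel \<and> (\<forall>b z. cmod z < 1 \<longrightarrow> cmod (D (b, z)) \<le> 1)"

lemma direction_factors:
  "direction_factor (\<lambda>p. direction (fst p) (snd p) ^ m)" "direction_factor (\<lambda>p. cnj (direction (fst p) (snd p)) ^ m)"
  by (auto simp: direction_factor_def norm_power norm_direction)

lemma measurable_ray_integral:
  assumes [measurable]: "H \<in> borel_measurable borel" and "direction_factor D"
  shows "ray_integral H D \<in> borel_measurable borel"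
proof -
  have [measurable]: "D \<in> borel_measurable borel" using assms by (simp add: direction_factor_def)
  show ?thesis
    unfolding ray_integral_def by (rule lborel.borel_measurable_lebesgue_integral) measurable
qed

text \<open>The pairing formula with the fibre integral evaluated: once its value \<open>I\<close>
  is known as a gauge integral, the pairing is a single integral over the disk.\<close>

lemma ray_integral_Gker:
  assumes H: "admissible H" and D: "direction_factor D" and k: "k \<ge> 1" and w: "cmod w < 1"
    and I: "\<And>z. cmod z < 1 \<Longrightarrow> ((\<lambda>b. D (b, z) * Gker k b (fan_coord b z) w * poisson b z) has_integral I z) {0..2*pi}"
  shows "set_integrable lborel ({0..<2*pi} \<times> UNIV) (\<lambda>p. ray_integral H D p * Gker k (fst p) (snd p) w)"
    and "(LINT p:{0..<2*pi} \<times> UNIV|lborel. ray_integral H D p * Gker k (fst p) (snd p) w) =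
      (LINT z:ball 0 1|lborel. H z / (cfac z)\<^sup>2 * I z)"
proof -
  have Dm [measurable]: "D \<in> borel_measurable borel" and D_le: "\<And>b z. cmod z < 1 \<Longrightarrow> cmod (D (b, z)) \<le> 1"
    using D by (auto simp: direction_factor_def)
  define G where "G = (\<lambda>p. Gker k (fst p) (snd p) w)"
  let ?C = "\<bar>Gconst k\<bar> / (1 - cmod w) ^ (4 * k)"
  have C: "?C \<ge> 0" using w by simp
  have Gm [measurable]: "G \<in> borel_measurable borel" unfolding G_def by (rule measurable_Gker[OF k w])
  have G_le: "cmod (G (b, a)) \<le> ?C * (1 / (1 + a\<^sup>2))" for b a
    using norm_Gker_le[OF k w] by (simp add: G_def)
  have I': "((\<lambda>b. D (b, z) * G (b, fan_coord b z) * poisson b z) has_integral I z) {0..2*pi}" if "cmod z < 1" for z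
    using I[OF that] by (simp add: G_def)
  note pairing = xray_pairing[OF H Dm D_le Gm G_le]
  show "set_integrable lborel ({0..<2*pi} \<times> UNIV) (\<lambda>p. ray_integral H D p * Gker k (fst p) (snd p) w)"
    using pairing(1) by (simp only: ray_integral_def G_def)
  have "(LINT p:{0..<2*pi} \<times> UNIV|lborel. ray_integral H D p * G p) =
      (LINT z:ball 0 1|lborel. H z / (cfac z)\<^sup>2 * (LINT b:{0..<2*pi}|lborel. D (b, z) * G (b, fan_coord b z) * poisson b z))"
    unfolding ray_integral_def by (rule pairing(2))
  also have "\<dots> = (LINT z:ball 0 1|lborel. H z / (cfac z)\<^sup>2 * I z)"
  proof (rule set_lebesgue_integral_cong)
    show "\<forall>z. z \<in> ball 0 1 \<longrightarrow> H z / (cfac z)\<^sup>2 * (LINT b:{0..<2*pi}|lborel. D (b, z) * G (b, fan_coord b z) * poisson b z) =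
        H z / (cfac z)\<^sup>2 * I z"
    proof (intro allI impI)
      fix z :: complex assume "z \<in> ball 0 1"
      then have z: "cmod z < 1" by simp
      have meas: "(\<lambda>b. D (b, z) * G (b, fan_coord b z) * poisson b z) \<in> borel_measurable borel"
        by measurable
      have le: "cmod (D (b, z) * G (b, fan_coord b z) * poisson b z) \<le> ?C * (poisson b z / (1 + (fan_coord b z)\<^sup>2))" for b
      proof -
        have "cmod (D (b, z) * G (b, fan_coord b z) * poisson b z) \<le> 1 * (?C * (1 / (1 + (fan_coord b z)\<^sup>2))) * poisson b z"
          unfolding norm_mult norm_of_real using poisson_pos[OF z, of b] C one_plus_sq_pos[of "fan_coord b z"]
          by (intro mult_mono D_le z G_le mult_nonneg_nonneg) auto
        then show ?thesis by (simp only: mult_1 mult.assoc times_divide_eq_left)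
      qed
      have "(LINT b:{0..<2*pi}|lborel. D (b, z) * G (b, fan_coord b z) * poisson b z) = I z"
        by (rule has_integral_Ico_lebesgue[OF meas z I'[OF z] le])
      then show "H z / (cfac z)\<^sup>2 * (LINT b:{0..<2*pi}|lborel. D (b, z) * G (b, fan_coord b z) * poisson b z) =
          H z / (cfac z)\<^sup>2 * I z"
        by simp
    qed
  qed simp
  finally show "(LINT p:{0..<2*pi} \<times> UNIV|lborel. ray_integral H D p * Gker k (fst p) (snd p) w) =
      (LINT z:ball 0 1|lborel. H z / (cfac z)\<^sup>2 * I z)"
    by (simp only: G_def)
qed

text \<open>\<open>xray_pairing\<close> is applied to the positive test function
  \<open>1 / (1 + a^2)\<close>, which is then divided out on each geodesic.\<close>

lemma AE_ray_integrable:
  assumes H: "admissible H" and D: "direction_factor D"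
  shows "AE p in lborel. p \<in> {0..<2*pi} \<times> UNIV \<longrightarrow>
    integrable lborel (\<lambda>t. H (geod (fst p) (snd p) t) * D (fst p, geod (fst p) (snd p) t))"
proof -
  have [measurable]: "D \<in> borel_measurable borel" and D_le: "\<And>b z. cmod z < 1 \<Longrightarrow> cmod (D (b, z)) \<le> 1"
    using D by (auto simp: direction_factor_def)
  define G where "G = (\<lambda>p::real\<times>real. complex_of_real (1 / (1 + (snd p)\<^sup>2)))"
  have [measurable]: "G \<in> borel_measurable borel" unfolding G_def by measurable
  have G_le: "cmod (G (b, a)) \<le> 1 * (1 / (1 + a\<^sup>2))" for b a
    unfolding G_def norm_of_real using one_plus_sq_pos[of a] by simp
  have "AE p in lborel. p \<in> {0..<2*pi} \<times> UNIV \<longrightarrow>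
      integrable lborel (\<lambda>t. H (geod (fst p) (snd p) t) * D (fst p, geod (fst p) (snd p) t) * G p)"
    by (rule xray_pairing(3)[where D=D and G=G and C=1, OF H _ D_le _ G_le]) simp_all
  then show ?thesis
  proof eventually_elim
    case (elim p)
    have "G p \<noteq> 0" using one_plus_sq_pos[of "snd p"] unfolding G_def of_real_eq_0_iff by simp
    then have "integrable lborel (\<lambda>t. H (geod (fst p) (snd p) t) * D (fst p, geod (fst p) (snd p) t) * G p * inverse (G p))"
      if "p \<in> {0..<2*pi} \<times> UNIV"
      using elim that by (rule_tac integrable_mult_left) blast
    then show ?case using \<open>G p \<noteq> 0\<close> by (simp add: mult.assoc[of _ "G p"])
  qed
qed

lemma tt_eval_geod:
  "tt_eval m hp hm (geod b a t) (geod_vel b a t) =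
    (hp (geod b a t) * cfac (geod b a t) ^ m) * direction b (geod b a t) ^ m +
    (hm (geod b a t) * cfac (geod b a t) ^ m) * cnj (direction b (geod b a t)) ^ m"
  by (simp add: tt_eval_def geod_vel_eq power_mult_distrib)

text \<open>Unit speed makes every factor of the metric equal to 1, so \<open>L\<close> does not
  change the data.\<close>

lemma gmet_geod: "gmet (geod b a t) (geod_vel b a t) = 1"
proof -
  have z: "cmod (geod b a t) < 1" by (rule geod_in_ball)
  then have "cfac (geod b a t) > 0" by (simp add: cfac_pos_iff)
  then show ?thesis
    by (simp add: gmet_def geod_vel_eq norm_mult norm_direction[OF z])
qed

text \<open>With \<open>1 - |z|^2 = 2 * cfac z\<close>, the weights
  \<open>cfac ^ (2 * k - 2)\<close> and \<open>(1 - |z|^2) ^ (2 * k)\<close> combine to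
  \<open>(1 - |z|^2) ^ (4 * k - 2)\<close>, matching the kernel exponent \<open>4 * k\<close>; this
  is \<open>bergman_reproducing\<close> with \<open>n = 4 * k - 2\<close>.\<close>

lemma bergman_cfac:
  fixes f :: "complex \<Rightarrow> complex"
  assumes hol: "f holomorphic_on ball 0 1" and adm: "admissible (\<lambda>z. f z * cfac z ^ (2 * k))"
    and f [measurable]: "f \<in> borel_measurable borel" and k: "k \<ge> 1" and w: "cmod w < 1"
  shows "(LINT z:ball 0 1|lborel. f z * cfac z ^ (2 * k) / (cfac z)\<^sup>2 *
      (2 * pi * Gconst k * ((1 - z * cnj z) ^ (2 * k) / (1 - cnj z * w) ^ (4 * k)))) = f w"
proof -
  let ?n = "4 * k - 2"
  have cz: "1 - z * cnj z = complex_of_real (2 * cfac z)" for z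
    by (simp add: cfac_def complex_norm_square del: of_real_power)
  have "set_integrable lborel (ball 0 1) (\<lambda>z. 2 ^ ?n * (cmod (f z * cfac z ^ (2 * k)) * bdf z / (cfac z)\<^sup>2))"
    using adm unfolding admissible_def by (intro set_integrable_mult_right) simp
  then have int: "set_integrable lborel (ball 0 1) (\<lambda>z. f z * (1 - z * cnj z) ^ ?n)"
  proof (rule set_integrable_bound)
    show "AE z in lborel. z \<in> ball 0 1 \<longrightarrow> cmod (f z * (1 - z * cnj z) ^ ?n) \<le>
        norm (2 ^ ?n * (cmod (f z * cfac z ^ (2 * k)) * bdf z / (cfac z)\<^sup>2))"
    proof (intro AE_I2 impI)
      fix z :: complex assume "z \<in> ball 0 1"
      then have z: "cmod z < 1" by simp
      then have c: "cfac z > 0" by (simp only: cfac_pos_iff)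
      have c1: "cfac z \<le> 1"
      proof -
        have le: "(1 - x) / 2 \<le> 1" if "0 \<le> x" for x :: real using that by simp
        show ?thesis unfolding cfac_def by (rule le) simp
      qed
      have "cfac z \<le> bdf z"
      proof -
        have x: "0 \<le> (cmod z)\<^sup>2" "(cmod z)\<^sup>2 \<le> 1" using z by (simp_all add: power_le_one)
        have "(1 - x) / 2 \<le> (1 - x) / (1 + x)" if "0 \<le> x" "x \<le> 1" for x :: real
          using that by (intro divide_left_mono) auto
        from this[OF x] show ?thesis by (simp only: cfac_def bdf_def)
      qed
      \<comment> \<open>\<open>cfac z \<le> 1\<close> and \<open>4 * k - 2 \<ge> 2 * k - 1\<close>;
        the lower exponent is the one controlled by \<open>admissible\<close>, since
        \<open>cfac \<le> bdf\<close>.\<close>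
      have "cfac z ^ ?n \<le> cfac z ^ (2 * k - 1)"
        using c c1 k by (intro power_decreasing) auto
      also have "\<dots> = cfac z ^ (2 * k) * cfac z / (cfac z)\<^sup>2"
        using c k by (simp add: power2_eq_square power_diff)
      also have "\<dots> \<le> cfac z ^ (2 * k) * bdf z / (cfac z)\<^sup>2"
        using c \<open>cfac z \<le> bdf z\<close> by (intro divide_right_mono mult_left_mono) auto
      finally have "2 ^ ?n * cmod (f z) * cfac z ^ ?n \<le> 2 ^ ?n * cmod (f z) * (cfac z ^ (2 * k) * bdf z / (cfac z)\<^sup>2)"
        by (intro mult_left_mono) auto
      then show "cmod (f z * (1 - z * cnj z) ^ ?n) \<le>
          norm (2 ^ ?n * (cmod (f z * cfac z ^ (2 * k)) * bdf z / (cfac z)\<^sup>2))"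
        using c bdf_pos[OF z] unfolding cz
        by (simp add: norm_mult norm_power power_mult_distrib mult_ac)
    qed
  qed (simp add: set_borel_measurable_def)
  have K: "?n + 2 = 4 * k" "Suc ?n = 4 * k - 1" "real (4 * k - 1) = 4 * real k - 1"
    using k by auto
  \<comment> \<open>\<open>2 * pi * Gconst k\<close> times \<open>4 / 4 ^ k\<close>, the factor left
    by trading \<open>cfac\<close> for \<open>1 - |z|^2\<close>. Multiplied by
    \<open>pi / (4 * k - 1)\<close> it gives 1.\<close>
  let ?K = "complex_of_real (8 * pi * Gconst k / 4 ^ k)"
  have "f z * cfac z ^ (2 * k) / (cfac z)\<^sup>2 * (2 * pi * Gconst k * ((1 - z * cnj z) ^ (2 * k) / (1 - cnj z * w) ^ (4 * k))) =
      ?K * (f z * (1 - z * cnj z) ^ ?n / (1 - cnj z * w) ^ (?n + 2))" if "z \<in> ball 0 1" for z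
  proof -
    let ?c = "complex_of_real (cfac z)"
    have c: "?c \<noteq> 0" using that cfac_pos_iff[of z] by simp
    have "(2 * ?c) ^ (2 * k) * ?c ^ (2 * k) = (2 * ?c) ^ ?n * (4 / 4 ^ k) * ?c\<^sup>2"
    proof -
      have "(2 * ?c) ^ (2 * k) * (2 * ?c) ^ (2 * k) = (2 * ?c) ^ ?n * (2 * ?c)\<^sup>2"
        by (simp only: power_add[symmetric] K(1)) simp
      moreover have "(2 * ?c) ^ (2 * k) = 4 ^ k * ?c ^ (2 * k)"
        by (simp add: power_mult_distrib power_mult)
      ultimately have "(2 * ?c) ^ (2 * k) * (4 ^ k * ?c ^ (2 * k)) = (2 * ?c) ^ ?n * (2 * ?c)\<^sup>2"
        by (simp only:)
      then have "4 ^ k * ((2 * ?c) ^ (2 * k) * ?c ^ (2 * k)) = 4 * ((2 * ?c) ^ ?n * ?c\<^sup>2)"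
        unfolding power_mult_distrib[of 2 ?c 2] by (simp only: mult_ac power2_eq_square) simp
      then show ?thesis by (simp add: field_simps)
    qed
    then have "f z * ?c ^ (2 * k) / ?c\<^sup>2 * (2 * pi * Gconst k * ((2 * ?c) ^ (2 * k) / D)) =
        2 * pi * Gconst k * (4 / 4 ^ k) * (f z * (2 * ?c) ^ ?n / D)" for D
      using c by (simp add: divide_simps) (simp add: mult_ac)
    from this[of "(1 - cnj z * w) ^ (4 * k)"] show ?thesis
      unfolding K(1) cz by (simp add: mult_ac)
  qed
  then have "(LINT z:ball 0 1|lborel. f z * cfac z ^ (2 * k) / (cfac z)\<^sup>2 *
      (2 * pi * Gconst k * ((1 - z * cnj z) ^ (2 * k) / (1 - cnj z * w) ^ (4 * k)))) =
      (LINT z:ball 0 1|lborel. ?K * (f z * (1 - z * cnj z) ^ ?n / (1 - cnj z * w) ^ (?n + 2)))"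
    by (intro set_lebesgue_integral_cong) simp_all
  also have "\<dots> = ?K * (pi / real (Suc ?n) * f w)"
    unfolding set_integral_mult_right bergman_reproducing[OF hol f int w] by simp
  also have "?K * (pi / real (Suc ?n) * f w) = complex_of_real (8 * pi * Gconst k / 4 ^ k * (pi / real (Suc ?n))) * f w"
    by simp
  also have "8 * pi * Gconst k / 4 ^ k * (pi / real (Suc ?n)) = 1"
    unfolding K(2,3) Gconst_def using k by (simp add: field_simps power2_eq_square)
  finally show ?thesis by simp
qed

lemma set_integral_sum_terms:
  fixes g :: "'i \<Rightarrow> 'a \<Rightarrow> 'b::{banach, second_countable_topology}"
  assumes "\<And>j. j \<in> A \<Longrightarrow> set_integrable M B (g j)"
  shows "set_integrable M B (\<lambda>p. \<Sum>j\<in>A. g j p)"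
    and "(LINT p:B|M. (\<Sum>j\<in>A. g j p)) = (\<Sum>j\<in>A. LINT p:B|M. g j p)"
  using assms unfolding set_integrable_def set_lebesgue_integral_def scaleR_sum_right
  by (auto intro!: Bochner_Integration.integrable_sum Bochner_Integration.integral_sum)

lemma set_integral_cnj:
  "(LINT p:B|M. cnj (f p)) = cnj (LINT p:B|M. f p)"
proof -
  have "indicat_real B p *\<^sub>R cnj (f p) = cnj (indicat_real B p *\<^sub>R f p)" for p
    by (simp add: scaleR_conv_of_real)
  then show ?thesis
    unfolding set_lebesgue_integral_def by (simp only: Bochner_Integration.integral_cnj)
qed

text \<open>Almost everywhere the reduced data \<open>X\<close> equal \<open>Y\<close>, the ray
  integrals of the components of order at most \<open>2 * k\<close>. Each of these pairs absolutely
  convergently with the kernel, and only the holomorphic one of order \<open>2 * k\<close>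
  contributes.\<close>

lemma recover_holomorphic_part:
  fixes d :: real and n :: nat
    and f0 :: "complex \<Rightarrow> complex"
    and fp fm :: "nat \<Rightarrow> complex \<Rightarrow> complex"
  assumes d: "0 < d"
    and f0: "wL2_scalar d f0"
    and tt: "\<And>k. k \<in> {1..n} \<Longrightarrow> wL2_tt d (2*k) (fp k) (fm k)"
    and div: "\<And>k. k \<in> {1..n} \<Longrightarrow> div_free_tt (fp k) (fm k)"
    and k: "k \<in> {1..n}" and w: "cmod w < 1"
  shows "fp k w = set_lebesgue_integral lborel ({0..<2*pi} \<times> UNIV)
        (\<lambda>(b,a). (xray (full_tensor n f0 fp fm) b a
                   - (\<Sum>j\<in>{k<..n}. xray (tt_eval (2*j) (fp j) (fm j)) b a)) * Gker k b a w)"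
proof -
  let ?B = "{0..<2*pi} \<times> (UNIV :: real set)"
  let ?G = "\<lambda>p. Gker k (fst p) (snd p) w"
  have k1: "k \<ge> 1" using k by simp
  define hp where "hp j = (\<lambda>z. fp j z * cfac z ^ (2 * j))" for j
  define hm where "hm j = (\<lambda>z. fm j z * cfac z ^ (2 * j))" for j
  define D where "D j = (\<lambda>p. direction (fst p) (snd p) ^ (2 * j))" for j
  define D' where "D' j = (\<lambda>p. cnj (direction (fst p) (snd p)) ^ (2 * j))" for j
  have D: "direction_factor (D j)" "direction_factor (D' j)" for j
    unfolding D_def D'_def by (rule direction_factors)+
  have adm0: "admissible f0" by (rule admissible_scalar[OF d f0])
  have adm: "admissible (hp j)" "admissible (hm j)" if "j \<in> {1..n}" for j
    unfolding hp_def hm_def by (rule admissible_tt[OF d tt[OF that]])+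
  define X where "X = (\<lambda>p. xray (full_tensor n f0 fp fm) (fst p) (snd p)
      - (\<Sum>j\<in>{k<..n}. xray (tt_eval (2*j) (fp j) (fm j)) (fst p) (snd p)))"
  define Y where "Y = (\<lambda>p. ray_integral f0 (D 0) p +
      (\<Sum>j\<in>{1..k}. ray_integral (hp j) (D j) p + ray_integral (hm j) (D' j) p))"
  have full: "full_tensor n f0 fp fm (geod b a t) (geod_vel b a t) = f0 (geod b a t) * D 0 (b, geod b a t) +
      (\<Sum>j=1..n. hp j (geod b a t) * D j (b, geod b a t) + hm j (geod b a t) * D' j (b, geod b a t))" for b a t
    by (simp add: full_tensor_def Lpow_def gmet_geod tt_eval_geod hp_def hm_def D_def D'_def)
  have tens: "tt_eval (2*j) (fp j) (fm j) (geod b a t) (geod_vel b a t) =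
      hp j (geod b a t) * D j (b, geod b a t) + hm j (geod b a t) * D' j (b, geod b a t)" for j b a t
    by (simp add: tt_eval_geod hp_def hm_def D_def D'_def)
  have [measurable]: "f0 \<in> borel_measurable borel" using adm0 by (simp add: admissible_def)
  have hm_meas: "hp j \<in> borel_measurable borel" "hm j \<in> borel_measurable borel" if "j \<in> {1..n}" for j
    using adm[OF that] by (simp_all add: admissible_def)
  have D_meas [measurable]: "D j \<in> borel_measurable borel" "D' j \<in> borel_measurable borel" for j
    using D[of j] by (simp_all add: direction_factor_def)
  \<comment> \<open>\<open>X\<close> and \<open>Y\<close> agree only almost everywhere, so equality
    of their integrals requires measurability of both.\<close>
  have X_meas: "X \<in> borel_measurable borel"
  proof -
    have "(\<lambda>p. xray (full_tensor n f0 fp fm) (fst p) (snd p)) \<in> borel_measurable borel"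
      unfolding xray_def full
    proof (rule lborel.borel_measurable_lebesgue_integral)
      have summand: "(\<lambda>x. hp j (geod (fst (fst x)) (snd (fst x)) (snd x)) * D j (fst (fst x), geod (fst (fst x)) (snd (fst x)) (snd x)) +
          hm j (geod (fst (fst x)) (snd (fst x)) (snd x)) * D' j (fst (fst x), geod (fst (fst x)) (snd (fst x)) (snd x)))
          \<in> borel_measurable ((borel :: (real \<times> real) measure) \<Otimes>\<^sub>M lborel)" if "j \<in> {1..n}" for j
      proof -
        note hm_meas[OF that, measurable]
        show ?thesis by measurable
      qed
      have first: "(\<lambda>x. f0 (geod (fst (fst x)) (snd (fst x)) (snd x)) * D 0 (fst (fst x), geod (fst (fst x)) (snd (fst x)) (snd x)))
          \<in> borel_measurable ((borel :: (real \<times> real) measure) \<Otimes>\<^sub>M lborel)"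
        by measurable
      show "(\<lambda>(p, t). f0 (geod (fst p) (snd p) t) * D 0 (fst p, geod (fst p) (snd p) t) +
          (\<Sum>j=1..n. hp j (geod (fst p) (snd p) t) * D j (fst p, geod (fst p) (snd p) t) +
            hm j (geod (fst p) (snd p) t) * D' j (fst p, geod (fst p) (snd p) t)))
          \<in> borel_measurable ((borel :: (real \<times> real) measure) \<Otimes>\<^sub>M lborel)"
        unfolding case_prod_beta' by (rule borel_measurable_add[OF first borel_measurable_sum[OF summand]])
    qed
    moreover have "(\<lambda>p. xray (tt_eval (2*j) (fp j) (fm j)) (fst p) (snd p)) \<in> borel_measurable borel" if "j \<in> {1..n}" for j
      unfolding xray_def tens
    proof (rule lborel.borel_measurable_lebesgue_integral)
      note hm_meas[OF that, measurable]
      show "(\<lambda>(p, t). hp j (geod (fst p) (snd p) t) * D j (fst p, geod (fst p) (snd p) t) +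
          hm j (geod (fst p) (snd p) t) * D' j (fst p, geod (fst p) (snd p) t))
          \<in> borel_measurable ((borel :: (real \<times> real) measure) \<Otimes>\<^sub>M lborel)"
        unfolding case_prod_beta' by measurable
    qed
    ultimately show ?thesis
      unfolding X_def by (intro borel_measurable_diff borel_measurable_sum) (use k in auto)
  qed
  have Y_meas: "Y \<in> borel_measurable borel"
    unfolding Y_def
    by (intro borel_measurable_add borel_measurable_sum measurable_ray_integral D hm_meas) (use k in auto)
  have G_meas: "?G \<in> borel_measurable borel" by (rule measurable_Gker[OF k1 w])
  have "AE p in lborel. p \<in> ?B \<longrightarrow> integrable lborel (\<lambda>t. f0 (geod (fst p) (snd p) t) * D 0 (fst p, geod (fst p) (snd p) t))"
    by (rule AE_ray_integrable[OF adm0 D(1)])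
  moreover have "AE p in lborel. \<forall>j\<in>{1..n}. p \<in> ?B \<longrightarrow> integrable lborel (\<lambda>t. hp j (geod (fst p) (snd p) t) * D j (fst p, geod (fst p) (snd p) t))"
    by (intro AE_finite_allI AE_ray_integrable adm D) auto
  moreover have "AE p in lborel. \<forall>j\<in>{1..n}. p \<in> ?B \<longrightarrow> integrable lborel (\<lambda>t. hm j (geod (fst p) (snd p) t) * D' j (fst p, geod (fst p) (snd p) t))"
    by (intro AE_finite_allI AE_ray_integrable adm D) auto
  \<comment> \<open>Finitely many exceptional null sets are discarded; on the remaining geodesics
    every component is integrable and the ray integral is additive.\<close>
  ultimately have XY: "AE p in lborel. p \<in> ?B \<longrightarrow> X p = Y p"
  proof eventually_elim
    case (elim p)
    show ?case
    proof
      assume p: "p \<in> ?B"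
      let ?R = "\<lambda>j. ray_integral (hp j) (D j) p + ray_integral (hm j) (D' j) p"
      have i: "integrable lborel (\<lambda>t. hp j (geod (fst p) (snd p) t) * D j (fst p, geod (fst p) (snd p) t))"
        "integrable lborel (\<lambda>t. hm j (geod (fst p) (snd p) t) * D' j (fst p, geod (fst p) (snd p) t))" if "j \<in> {1..n}" for j
        using elim p that by blast+
      have "xray (tt_eval (2*j) (fp j) (fm j)) (fst p) (snd p) = ?R j" if "j \<in> {1..n}" for j
        unfolding xray_def tens ray_integral_def using i[OF that] by (rule Bochner_Integration.integral_add)
      moreover have "xray (full_tensor n f0 fp fm) (fst p) (snd p) = ray_integral f0 (D 0) p + (\<Sum>j=1..n. ?R j)"
      proof -
        have sum: "integrable lborel (\<lambda>t. hp j (geod (fst p) (snd p) t) * D j (fst p, geod (fst p) (snd p) t) +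
            hm j (geod (fst p) (snd p) t) * D' j (fst p, geod (fst p) (snd p) t))" if "j \<in> {1..n}" for j
          using i[OF that] by (rule Bochner_Integration.integrable_add)
        have i0: "integrable lborel (\<lambda>t. f0 (geod (fst p) (snd p) t) * D 0 (fst p, geod (fst p) (snd p) t))"
          using elim(1) p by blast
        have isum: "integrable lborel (\<lambda>t. \<Sum>j=1..n. hp j (geod (fst p) (snd p) t) * D j (fst p, geod (fst p) (snd p) t) +
            hm j (geod (fst p) (snd p) t) * D' j (fst p, geod (fst p) (snd p) t))"
          by (rule Bochner_Integration.integrable_sum) (rule sum)
        have "(LINT t|lborel. (\<Sum>j=1..n. hp j (geod (fst p) (snd p) t) * D j (fst p, geod (fst p) (snd p) t) +
            hm j (geod (fst p) (snd p) t) * D' j (fst p, geod (fst p) (snd p) t))) = (\<Sum>j=1..n. ?R j)"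
          unfolding ray_integral_def
          by (subst Bochner_Integration.integral_sum[OF sum])
            (auto intro!: sum.cong Bochner_Integration.integral_add i)
        then show ?thesis
          unfolding xray_def full Bochner_Integration.integral_add[OF i0 isum]
          by (simp only: ray_integral_def[of f0])
      qed
      moreover have "(\<Sum>j=1..n. ?R j) = (\<Sum>j=1..k. ?R j) + (\<Sum>j\<in>{k<..n}. ?R j)"
      proof -
        have "{1..n} = {1..k} \<union> {k<..n}" using k by auto
        then show ?thesis by (simp add: sum.union_disjoint ivl_disj_int)
      qed
      ultimately show "X p = Y p" using k by (simp add: X_def Y_def)
    qed
  qed
  note J = Gker_mode_integrals[OF k1 w]
  \<comment> \<open>The scalar part is treated as a component of order 0, which lies below
    \<open>2 * k\<close> because \<open>k \<ge> 1\<close>.\<close>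
  have I0: "set_integrable lborel ?B (\<lambda>p. ray_integral f0 (D 0) p * ?G p)"
    "(LINT p:?B|lborel. ray_integral f0 (D 0) p * ?G p) = 0"
    using ray_integral_Gker[OF adm0 D(1) k1 w, of 0 "\<lambda>_. 0"] J(1)[of _ 0] k1 by (simp_all add: D_def)
  have Im: "set_integrable lborel ?B (\<lambda>p. ray_integral (hm j) (D' j) p * ?G p)"
    "(LINT p:?B|lborel. ray_integral (hm j) (D' j) p * ?G p) = 0" if "j \<in> {1..n}" for j
    using ray_integral_Gker[OF adm(2)[OF that] D(2) k1 w, of j "\<lambda>_. 0"] J(3)[of _ j] by (simp_all add: D'_def)
  have Ip: "set_integrable lborel ?B (\<lambda>p. ray_integral (hp j) (D j) p * ?G p)"
    "(LINT p:?B|lborel. ray_integral (hp j) (D j) p * ?G p) = 0" if "j \<in> {1..<k}" for j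
    using ray_integral_Gker[OF adm(1) D(1) k1 w, of j j "\<lambda>_. 0"] J(1)[of _ j] that k by (simp_all add: D_def)
  have Ik: "set_integrable lborel ?B (\<lambda>p. ray_integral (hp k) (D k) p * ?G p)"
    "(LINT p:?B|lborel. ray_integral (hp k) (D k) p * ?G p) = fp k w"
  proof -
    have J2: "((\<lambda>b. D k (b, z) * Gker k b (fan_coord b z) w * poisson b z) has_integral
        2 * pi * Gconst k * ((1 - z * cnj z) ^ (2 * k) / (1 - cnj z * w) ^ (4 * k))) {0..2*pi}" if "cmod z < 1" for z
      using J(2)[OF that] by (simp only: D_def fst_conv snd_conv)
    note R = ray_integral_Gker[OF adm(1)[OF k] D(1) k1 w]
    have meas: "fp k \<in> borel_measurable borel" and hol: "fp k holomorphic_on ball 0 1"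
      using tt[OF k] div[OF k] by (simp_all add: wL2_tt_def div_free_tt_def)
    show "set_integrable lborel ?B (\<lambda>p. ray_integral (hp k) (D k) p * ?G p)"
      by (rule R(1)) (rule J2)
    show "(LINT p:?B|lborel. ray_integral (hp k) (D k) p * ?G p) = fp k w"
    proof -
      have "(LINT p:?B|lborel. ray_integral (hp k) (D k) p * ?G p) = (LINT z:ball 0 1|lborel. hp k z / (cfac z)\<^sup>2 *
          (2 * pi * Gconst k * ((1 - z * cnj z) ^ (2 * k) / (1 - cnj z * w) ^ (4 * k))))"
        by (rule R(2)) (rule J2)
      also have "\<dots> = fp k w"
        unfolding hp_def by (rule bergman_cfac[OF hol adm(1)[OF k, unfolded hp_def] meas k1 w])
      finally show ?thesis .
    qed
  qed
  have ip: "set_integrable lborel ?B (\<lambda>p. ray_integral (hp j) (D j) p * ?G p)" if "j \<in> {1..k}" for j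
    using Ip(1)[of j] Ik(1) that by (cases "j = k") auto
  have "(LINT p:?B|lborel. X p * ?G p) = (LINT p:?B|lborel. Y p * ?G p)"
    unfolding set_lebesgue_integral_def
  proof (rule integral_cong_AE)
    show "AE p in lborel. indicat_real ?B p *\<^sub>R (X p * ?G p) = indicat_real ?B p *\<^sub>R (Y p * ?G p)"
      using XY by eventually_elim (auto simp: indicator_def)
    have B: "indicat_real ?B \<in> borel_measurable lborel"
      by (intro borel_measurable_indicator) (simp add: borel_Times)
    show "(\<lambda>p. indicat_real ?B p *\<^sub>R (X p * ?G p)) \<in> borel_measurable lborel"
      "(\<lambda>p. indicat_real ?B p *\<^sub>R (Y p * ?G p)) \<in> borel_measurable lborel"
      using X_meas Y_meas G_meas by (intro borel_measurable_scaleR[OF B] borel_measurable_times; simp)+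
  qed
  also have "\<dots> = (LINT p:?B|lborel. ray_integral f0 (D 0) p * ?G p +
      (\<Sum>j\<in>{1..k}. ray_integral (hp j) (D j) p * ?G p + ray_integral (hm j) (D' j) p * ?G p))"
    by (simp add: Y_def distrib_right sum_distrib_right)
  also have "\<dots> = (LINT p:?B|lborel. ray_integral f0 (D 0) p * ?G p) +
      (\<Sum>j\<in>{1..k}. (LINT p:?B|lborel. ray_integral (hp j) (D j) p * ?G p) + (LINT p:?B|lborel. ray_integral (hm j) (D' j) p * ?G p))"
  proof -
    have s: "set_integrable lborel ?B (\<lambda>p. ray_integral (hp j) (D j) p * ?G p + ray_integral (hm j) (D' j) p * ?G p)"
      "(LINT p:?B|lborel. ray_integral (hp j) (D j) p * ?G p + ray_integral (hm j) (D' j) p * ?G p) =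
        (LINT p:?B|lborel. ray_integral (hp j) (D j) p * ?G p) + (LINT p:?B|lborel. ray_integral (hm j) (D' j) p * ?G p)"
      if "j \<in> {1..k}" for j
      using set_integral_add[OF ip[OF that] Im(1)[of j]] that k by auto
    let ?S = "\<lambda>j p. ray_integral (hp j) (D j) p * ?G p + ray_integral (hm j) (D' j) p * ?G p"
    have "set_integrable lborel ?B (\<lambda>p. \<Sum>j\<in>{1..k}. ?S j p)"
      by (rule set_integral_sum_terms(1)) (rule s(1))
    moreover have "(LINT p:?B|lborel. (\<Sum>j\<in>{1..k}. ?S j p)) = (\<Sum>j\<in>{1..k}. LINT p:?B|lborel. ?S j p)"
      by (rule set_integral_sum_terms(2)) (rule s(1))
    moreover have "(\<Sum>j\<in>{1..k}. LINT p:?B|lborel. ?S j p) =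
        (\<Sum>j\<in>{1..k}. (LINT p:?B|lborel. ray_integral (hp j) (D j) p * ?G p) + (LINT p:?B|lborel. ray_integral (hm j) (D' j) p * ?G p))"
      by (rule sum.cong[OF refl s(2)])
    ultimately show ?thesis
      by (simp only: set_integral_add(2)[OF I0(1)])
  qed
  also have "\<dots> = (\<Sum>j\<in>{1..k}. if j = k then fp k w else 0)"
  proof -
    have "(LINT p:?B|lborel. ray_integral (hp j) (D j) p * ?G p) + (LINT p:?B|lborel. ray_integral (hm j) (D' j) p * ?G p) =
        (if j = k then fp k w else 0)" if "j \<in> {1..k}" for j
      using Im(2)[of j] Ip(2)[of j] Ik(2) k that by (cases "j = k") simp_all
    then show ?thesis unfolding I0(2) add_0_left by (rule sum.cong[OF refl])
  qed
  also have "\<dots> = fp k w" using k by simp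
  finally show ?thesis by (simp add: X_def case_prod_beta')
qed

lemma wL2_tt_cnj:
  assumes "wL2_tt d m hp hm"
  shows "wL2_tt d m (\<lambda>z. cnj (hm z)) (\<lambda>z. cnj (hp z))"
  using assms by (auto simp: wL2_tt_def add.commute)

lemma xray_cnj: "xray (\<lambda>z v. cnj (F z v)) b a = cnj (xray F b a)"
  by (simp add: xray_def)

theorem theorem2p13:
  fixes d :: real and n :: nat
    and f0 :: "complex \<Rightarrow> complex"
    and fp fm :: "nat \<Rightarrow> complex \<Rightarrow> complex"
  assumes "0 < d" "d < 3/2"
    and "wL2_scalar d f0"
    and "\<And>k. k \<in> {1..n} \<Longrightarrow> wL2_tt d (2*k) (fp k) (fm k)"
    and "\<And>k. k \<in> {1..n} \<Longrightarrow> div_free_tt (fp k) (fm k)"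
  shows "\<forall>k\<in>{1..n}. \<forall>z\<in>ball 0 1.
     fp k z = set_lebesgue_integral lborel ({0..<2*pi} \<times> UNIV)
        (\<lambda>(b,a). (xray (full_tensor n f0 fp fm) b a
                   - (\<Sum>j\<in>{k<..n}. xray (tt_eval (2*j) (fp j) (fm j)) b a)) * Gker k b a z)
   \<and> fm k z = set_lebesgue_integral lborel ({0..<2*pi} \<times> UNIV)
        (\<lambda>(b,a). (xray (full_tensor n f0 fp fm) b a
                   - (\<Sum>j\<in>{k<..n}. xray (tt_eval (2*j) (fp j) (fm j)) b a)) * cnj (Gker k b a z))"
proof (intro ballI conjI)
  fix k z assume k: "k \<in> {1..n}" and "z \<in> ball (0::complex) 1"
  then have z: "cmod z < 1" by simp
  show "fp k z = set_lebesgue_integral lborel ({0..<2*pi} \<times> UNIV)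
        (\<lambda>(b,a). (xray (full_tensor n f0 fp fm) b a
                   - (\<Sum>j\<in>{k<..n}. xray (tt_eval (2*j) (fp j) (fm j)) b a)) * Gker k b a z)"
    by (rule recover_holomorphic_part[OF assms(1,3,4,5) k z])
  \<comment> \<open>Conjugation exchanges the two kinds of components: \<open>cnj (fm k)\<close> is
    holomorphic by the divergence condition, and as the metric is real the data are conjugated too.
    The holomorphic case then yields the conjugate of the second formula.\<close>
  let ?g0 = "\<lambda>z. cnj (f0 z)" and ?gp = "\<lambda>k z. cnj (fm k z)" and ?gm = "\<lambda>k z. cnj (fp k z)"
  have tens: "tt_eval m (?gp j) (?gm j) = (\<lambda>z v. cnj (tt_eval m (fp j) (fm j) z v))" for m j
    by (simp add: tt_eval_def fun_eq_iff)
  have full: "full_tensor n ?g0 ?gp ?gm = (\<lambda>z v. cnj (full_tensor n f0 fp fm z v))"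
    by (simp add: full_tensor_def Lpow_def tens gmet_def fun_eq_iff)
  have "wL2_scalar d ?g0"
    using assms(3) by (auto simp: wL2_scalar_def)
  moreover have "wL2_tt d (2*k) (?gp k) (?gm k)" if "k \<in> {1..n}" for k
    by (rule wL2_tt_cnj[OF assms(4)[OF that]])
  moreover have "div_free_tt (?gp k) (?gm k)" if "k \<in> {1..n}" for k
    using assms(5)[OF that] by (simp add: div_free_tt_def)
  ultimately have "?gp k z = set_lebesgue_integral lborel ({0..<2*pi} \<times> UNIV)
        (\<lambda>(b,a). (xray (full_tensor n ?g0 ?gp ?gm) b a
                   - (\<Sum>j\<in>{k<..n}. xray (tt_eval (2*j) (?gp j) (?gm j)) b a)) * Gker k b a z)"
    by (rule recover_holomorphic_part[OF assms(1) _ _ _ k z])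
  also have "\<dots> = (LINT p:{0..<2*pi} \<times> UNIV|lborel. cnj (case p of (b, a) \<Rightarrow>
      (xray (full_tensor n f0 fp fm) b a - (\<Sum>j\<in>{k<..n}. xray (tt_eval (2*j) (fp j) (fm j)) b a)) * cnj (Gker k b a z)))"
    by (simp add: full tens xray_cnj case_prod_beta')
  finally show "fm k z = set_lebesgue_integral lborel ({0..<2*pi} \<times> UNIV)
        (\<lambda>(b,a). (xray (full_tensor n f0 fp fm) b a
                   - (\<Sum>j\<in>{k<..n}. xray (tt_eval (2*j) (fp j) (fm j)) b a)) * cnj (Gker k b a z))"
    unfolding set_integral_cnj by (simp only: complex_cnj_cancel_iff)
qed

end
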